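(* Let $n\ge1$ and let $\tilde t=(t_0,t_1,\bar t_1,t_2,\bar t_2,\dots)$ be such that $t_i=\bar t_i=0$ for $i>n$, $0<t_0<1$, and $|t_i|,|\bar t_i|\le(4n^32^ne^n)^{-1}$ for $1\le i\le n$. Then the series $$F(\tilde t)=\frac12 t_0^2\log t_0-\frac34 t_0^2+\sum \frac{i_1^{n_1}\cdots i_k^{n_k}}{n_1!\cdots n_k!}\,\frac{\bar i_1^{\bar n_1}\cdots \bar i_{\bar k}^{\bar n_{\bar k}}}{\bar n_1!\cdots \bar n_{\bar k}!}\,N_i^2\left(\begin{matrix} i_1,\dots,i_k\\ n_1,\dots,n_k\end{matrix}\,\middle|\,\begin{matrix}\bar i_1,\dots,\bar i_{\bar k}\\ \bar n_1,\dots,\bar n_{\bar k}\end{matrix}\right) t_0^{\,i-(n_1+\dots+n_k+\bar n_1+\dots+\bar n_{\bar k})+2}\, t_{i_1}^{n_1}\cdots t_{i_k}^{n_k}\,\bar t_{\bar i_1}^{\bar n_1}\cdots\bar t_{\bar i_{\bar k}}^{\bar n_{\bar k}}$$ converges, where the sum is over all integers $i\ge1$, $k,\bar k\ge 1$, $0<i_1<\dots<i_k$, $0<\bar i_1<\dots<\bar i_{\bar k}$, $n_r,\bar n_r\ge 1$ with $i-(n_1+\dots+n_k+\bar n_1+\dots+\bar n_{\bar k})+2\ge 0$.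
   Context: Here $t_0$ is real, $t_i$ ($i\ge1$) are complex and $\bar t_i$ is the complex conjugate of $t_i$. The numbers $N_i^2$ are defined by the following rules. All indices are positive integers unless stated otherwise. 1) $P_{i,j}(s_1,\dots,s_m)=\#\{(i_1,\dots,i_m): i=i_1+\dots+i_m,\ 1\le i_r\le s_r-1\}$. 2) $T^1_{i,j}(s_1,\dots,s_m)=\sum\frac1{k\,n_1!\cdots n_k!}P_{i,j}\big(s_1+\dots+s_{n_1},\ s_{n_1+1}+\dots+s_{n_1+n_2},\ \dots,\ s_{n_1+\dots+n_{k-1}+1}+\dots+s_{n_1+\dots+n_k}\big)$, the sum over $k\ge1$ and $n_1,\dots,n_k\ge1$ with $n_1+\dots+n_k=m$. $T^2_{i_1,i_2}\left(\begin{matrix}s_1,\dots,s_m\\1,\dots,1\end{matrix}\right)=T^1_{i_1,i_2}(s_1,\dots,s_m)$, and for $k\ge3$ $$T^2_{i_1,\dots,i_k}\left(\begin{matrix}s_1,\dots,s_m\\l_1,\dots,l_m\end{matrix}\right)=\sum_{1\le i\le j\le m,\ s,l\ge1} l\;T^1_{s,i_k}(s_i,\dots,s_j)\;T^2_{i_1,\dots,i_{k-1}}\left(\begin{matrix}s_1,\dots,s_{i-1},s,s_{j+1},\dots,s_m\\l_1,\dots,l_{i-1},l,l_{j+1},\dots,l_m\end{matrix}\right),$$ where $s=s_i+\dots+s_j-i_k$, $l=(l_i-1)+\dots+(l_j-1)$ (only pairs $i\le j$ with $s,l\ge1$ contribute). Here always $s_1+\dots+s_m=i_1+\dots+i_k$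 and $(l_1-1)+\dots+(l_m-1)=k-2$. 3) $$S_{\bar i_1,\dots,\bar i_{\bar k}}\left(\begin{matrix}s_1,\dots,s_m\\l_1,\dots,l_m\end{matrix}\right)=\sum\prod_{r=1}^m\frac{(s_r-1)!}{(s_r-n_r-l_r+1)!\,(l_r-1)!},$$ the sum over all ordered decompositions $\{\bar i_1,\dots,\bar i_{\bar k}\}=\{\bar i_1^1,\dots,\bar i_1^{n_1}\}\sqcup\dots\sqcup\{\bar i_m^1,\dots,\bar i_m^{n_m}\}$ (the $\bar i$'s being regarded as labelled, i.e. distinguishable) with $\bar i_r^1+\dots+\bar i_r^{n_r}=s_r$ and $s_r-n_r-l_r+1\ge0$ for all $r$. 4) $N^1_i(i_1,\dots,i_k|\bar i_1,\dots,\bar i_{\bar k})=0$ if $i\ne i_1+\dots+i_k$ or $i\ne\bar i_1+\dots+\bar i_{\bar k}$. In the other cases: $N^1_i(i|\bar i_1,\dots,\bar i_{\bar k})=\frac{(i-1)!}{(i-\bar k+1)!}$; $N^1_i(i_1,\dots,i_k|\bar i)=\frac{(i-1)!}{(i-k+1)!}$; and for $k,\bar k>1$ $$N^1_i(i_1,\dots,i_k|\bar i_1,\dots,\bar i_{\bar k})=\sum(-1)^{m+1}S_{\bar i_1,\dots,\bar i_{\bar k}}\left(\begin{matrix}s_1,\dots,s_m\\l_1,\dots,l_m\end{matrix}\right)T^2_{i_1,\dots,i_k}\left(\begin{matrix}s_1,\dots,s_m\\l_1,\dots,l_m\end{matrix}\right),$$ the sum over $m\ge1$ and $s_r,l_r\ge1$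 with $s_1+\dots+s_m=i_1+\dots+i_k$, $l_1+\dots+l_m=m+k-2$. Finally $N_i^2\left(\begin{matrix} i_1,\dots,i_k\\ n_1,\dots,n_k\end{matrix}\,\middle|\,\begin{matrix}\bar i_1,\dots,\bar i_{\bar k}\\ \bar n_1,\dots,\bar n_{\bar k}\end{matrix}\right)=N_i^1(i_1,\dots,i_1,\dots,i_k,\dots,i_k\,|\,\bar i_1,\dots,\bar i_1,\dots,\bar i_{\bar k},\dots,\bar i_{\bar k})$, where each $i_r$ is repeated $n_r$ times and each $\bar i_r$ is repeated $\bar n_r$ times. *)

theory Defs
  imports "HOL-Analysis.Analysis"
begin

text \<open>
  Tuples are lists of natural numbers, so the entry written $s_r$ on paper is \<open>ss ! (r - 1)\<close>.
  Sums over infinite sets are \<open>0\<close> by convention in HOL; the finiteness lemmas below show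
  that the finite sums used here do not fall into this case.
\<close>

definition compositions :: "nat \<Rightarrow> nat list set" where
  "compositions m = {ns. sum_list ns = m \<and> (\<forall>n\<in>set ns. 1 \<le> n)}"

text \<open>
  In \<open>coef_P i j ss\<close> and \<open>coef_T1 i j ss\<close> the index \<open>j\<close> is kept only to match the
  notation $P_{i,j}$, $T^1_{i,j}$: it does not occur in the defining formulas, and whenever
  these numbers are used one has $i + j = s_1 + \dots + s_m$.
\<close>

definition coef_P :: "nat \<Rightarrow> nat \<Rightarrow> nat list \<Rightarrow> nat" where
  "coef_P i j ss = card {xs. length xs = length ss \<and> sum_list xs = i \<and>
     (\<forall>r<length ss. 1 \<le> xs ! r \<and> xs ! r \<le> ss ! r - 1)}"

primrec block_sums :: "nat list \<Rightarrow> nat list \<Rightarrow> nat list" where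
  "block_sums [] ss = []"
| "block_sums (n # ns) ss = sum_list (take n ss) # block_sums ns (drop n ss)"

definition coef_T1 :: "nat \<Rightarrow> nat \<Rightarrow> nat list \<Rightarrow> real" where
  "coef_T1 i j ss = (\<Sum>ns\<in>compositions (length ss).
     1 / (real (length ns) * (\<Prod>n\<leftarrow>ns. fact n)) * real (coef_P i j (block_sums ns ss)))"

text \<open>The entries of \<open>xs\<close> at the (zero-based) positions \<open>a, \<dots>, b\<close>, and their replacement
  by a single entry \<open>x\<close>.\<close>

definition slice :: "nat \<Rightarrow> nat \<Rightarrow> 'a list \<Rightarrow> 'a list" where
  "slice a b xs = take (b + 1 - a) (drop a xs)"

definition replace_slice :: "nat \<Rightarrow> nat \<Rightarrow> 'a \<Rightarrow> 'a list \<Rightarrow> 'a list" where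
  "replace_slice a b x xs = take a xs @ x # drop (b + 1) xs"

definition merged_l :: "nat \<Rightarrow> nat \<Rightarrow> nat list \<Rightarrow> nat" where
  "merged_l a b ls = (\<Sum>l\<leftarrow>slice a b ls. l - 1)"

text \<open>
  \<open>coef_T2 [i\<^sub>1, \<dots>, i\<^sub>k] [s\<^sub>1, \<dots>, s\<^sub>m] [l\<^sub>1, \<dots>, l\<^sub>m]\<close>. For $k = 2$ it is defined on paper only for
  $l_1 = \dots = l_m = 1$, which the standing condition $(l_1-1)+\dots+(l_m-1)=k-2$ forces.
  The value \<open>0\<close> for the remaining arguments with $k \le 2$ is a placeholder that is never
  reached from \<open>coef_N1\<close>. In the recursion the condition \<open>last is < sum_list \<dots>\<close> is $s \ge 1$,
  so the subtraction in $s = s_i + \dots + s_j - i_k$ is not truncated.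
\<close>

function coef_T2 :: "nat list \<Rightarrow> nat list \<Rightarrow> nat list \<Rightarrow> real" where
  "coef_T2 is ss ls =
    (if length is \<le> 1 then 0
     else if length is = 2 then
       (if \<forall>l\<in>set ls. l = 1 then coef_T1 (is ! 0) (is ! 1) ss else 0)
     else
       (\<Sum>(a, b) \<in> {(a, b). a \<le> b \<and> b < length ss \<and>
                     last is < sum_list (slice a b ss) \<and> 1 \<le> merged_l a b ls}.
          real (merged_l a b ls) *
          coef_T1 (sum_list (slice a b ss) - last is) (last is) (slice a b ss) *
          coef_T2 (butlast is)
            (replace_slice a b (sum_list (slice a b ss) - last is) ss)
            (replace_slice a b (merged_l a b ls) ls)))"
  by pat_completeness auto
termination
  by (relation "Wellfounded.measure (\<lambda>(is, ss, ls). length is)") auto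

declare coef_T2.simps [simp del]

text \<open>
  Ordered decompositions of the labelled numbers \<open>js ! 0, js ! 1, \<dots>\<close> into blocks with
  prescribed sums: the \<open>r\<close>-th block is the set \<open>A r\<close> of labels (positions in \<open>js\<close>), so equal
  entries of \<open>js\<close> at different positions are distinguished and $n_r$ is \<open>card (A r)\<close>.
\<close>

definition decompositions :: "nat list \<Rightarrow> nat list \<Rightarrow> (nat \<Rightarrow> nat set) set" where
  "decompositions js ss = {A \<in> {..<length ss} \<rightarrow>\<^sub>E Pow {..<length js}.
     disjoint_family_on A {..<length ss} \<and> (\<Union>r<length ss. A r) = {..<length js} \<and>
     (\<forall>r<length ss. (\<Sum>q\<in>A r. js ! q) = ss ! r)}"

definition coef_S :: "nat list \<Rightarrow> nat list \<Rightarrow> nat list \<Rightarrow> real" where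
  "coef_S js ss ls =
    (\<Sum>A \<in> {A \<in> decompositions js ss. \<forall>r<length ss. card (A r) + ls ! r \<le> ss ! r + 1}.
       \<Prod>r<length ss. fact (ss ! r - 1) /
         (fact (ss ! r + 1 - (card (A r) + ls ! r)) * fact (ls ! r - 1)))"

definition N1_range :: "nat list \<Rightarrow> (nat list \<times> nat list) set" where
  "N1_range is = {(ss, ls). 1 \<le> length ss \<and> length ls = length ss \<and>
     (\<forall>s\<in>set ss. 1 \<le> s) \<and> (\<forall>l\<in>set ls. 1 \<le> l) \<and>
     sum_list ss = sum_list is \<and> sum_list ls = length ss + length is - 2}"

text \<open>
  A tuple of $k$ positive integers with sum $i$ has $k \le i$, so \<open>i + 1 - length js\<close> and
  \<open>i + 1 - length is\<close> are not truncated.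
\<close>

definition coef_N1 :: "nat \<Rightarrow> nat list \<Rightarrow> nat list \<Rightarrow> real" where
  "coef_N1 i is js =
    (if i \<noteq> sum_list is \<or> i \<noteq> sum_list js then 0
     else if length is = 1 then fact (i - 1) / fact (i + 1 - length js)
     else if length js = 1 then fact (i - 1) / fact (i + 1 - length is)
     else (\<Sum>(ss, ls)\<in>N1_range is.
             (-1) ^ (length ss + 1) * coef_S js ss ls * coef_T2 is ss ls))"

text \<open>From here on, a two-row array with columns $(i_r, n_r)$ is the list of these pairs.\<close>

definition repeat_entries :: "(nat \<times> nat) list \<Rightarrow> nat list" where
  "repeat_entries ps = concat (map (\<lambda>(j, m). replicate m j) ps)"

definition coef_N2 :: "nat \<Rightarrow> (nat \<times> nat) list \<Rightarrow> (nat \<times> nat) list \<Rightarrow> real" where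
  "coef_N2 i ps qs = coef_N1 i (repeat_entries ps) (repeat_entries qs)"

definition multi_index :: "(nat \<times> nat) list set" where
  "multi_index = {ps. ps \<noteq> [] \<and> sorted_wrt (<) (map fst ps) \<and> (\<forall>(j, m)\<in>set ps. 1 \<le> j \<and> 1 \<le> m)}"

definition multiplicity_sum :: "(nat \<times> nat) list \<Rightarrow> nat" where
  "multiplicity_sum ps = (\<Sum>(j, m)\<leftarrow>ps. m)"

text \<open>The last condition says that the exponent of $t_0$ is nonnegative.\<close>

definition F_indices :: "(nat \<times> (nat \<times> nat) list \<times> (nat \<times> nat) list) set" where
  "F_indices = {(i, ps, qs). 1 \<le> i \<and> ps \<in> multi_index \<and> qs \<in> multi_index \<and>
     multiplicity_sum ps + multiplicity_sum qs \<le> i + 2}"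

fun F_term :: "real \<Rightarrow> (nat \<Rightarrow> complex) \<Rightarrow> nat \<times> (nat \<times> nat) list \<times> (nat \<times> nat) list \<Rightarrow> complex" where
  "F_term t0 t (i, ps, qs) =
     of_real ((\<Prod>(j, m)\<leftarrow>ps. real j ^ m / fact m) * (\<Prod>(j, m)\<leftarrow>qs. real j ^ m / fact m)
       * coef_N2 i ps qs * t0 ^ (i + 2 - (multiplicity_sum ps + multiplicity_sum qs)))
     * (\<Prod>(j, m)\<leftarrow>ps. t j ^ m) * (\<Prod>(j, m)\<leftarrow>qs. cnj (t j) ^ m)"

lemma finite_positive_lists_sum_le:
  "finite {xs :: nat list. sum_list xs \<le> N \<and> (\<forall>x\<in>set xs. 1 \<le> x)}"
proof (rule finite_subset)
  show "{xs :: nat list. sum_list xs \<le> N \<and> (\<forall>x\<in>set xs. 1 \<le> x)}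
      \<subseteq> {xs. set xs \<subseteq> {..N} \<and> length xs \<le> N}"
  proof safe
    fix xs :: "nat list" and x
    assume N: "sum_list xs \<le> N" and pos: "\<forall>x\<in>set xs. 1 \<le> x"
    show "x \<le> N" if "x \<in> set xs" using member_le_sum_list[OF that] N by simp
    have "length xs \<le> sum_list xs" using pos by (induction xs) auto
    then show "length xs \<le> N" using N by simp
  qed
qed (rule finite_lists_length_le, simp)

lemma finite_compositions: "finite (compositions m)"
  by (rule finite_subset[OF _ finite_positive_lists_sum_le[of m]]) (auto simp: compositions_def)

lemma finite_coef_P_set:
  "finite {xs :: nat list. length xs = length ss \<and> sum_list xs = i \<and>
     (\<forall>r<length ss. 1 \<le> xs ! r \<and> xs ! r \<le> ss ! r - 1)}"
  by (rule finite_subset[OF _ finite_positive_lists_sum_le[of i]]) (auto simp: in_set_conv_nth)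

lemma finite_coef_T2_range: "finite {(a, b). a \<le> b \<and> b < (n::nat) \<and> Q a b}"
  by (rule finite_subset[of _ "{..n} \<times> {..n}"]) auto

lemma finite_decompositions: "finite (decompositions js ss)"
  by (rule finite_subset[of _ "{..<length ss} \<rightarrow>\<^sub>E Pow {..<length js}"])
    (auto simp: decompositions_def intro!: finite_PiE)

lemma finite_N1_range: "finite (N1_range is)"
proof (rule finite_subset)
  let ?L = "\<lambda>N. {xs :: nat list. sum_list xs \<le> N \<and> (\<forall>x\<in>set xs. 1 \<le> x)}"
  show "N1_range is \<subseteq> ?L (sum_list is) \<times> ?L (sum_list is + length is)"
  proof safe
    fix ss ls assume *: "(ss, ls) \<in> N1_range is"
    then have "\<forall>s\<in>set ss. 1 \<le> s" by (auto simp: N1_range_def)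
    then have "length ss \<le> sum_list ss" by (induction ss) auto
    then show "sum_list ls \<le> sum_list is + length is" using * by (auto simp: N1_range_def)
  qed (auto simp: N1_range_def Suc_le_eq)
  show "finite (?L (sum_list is) \<times> ?L (sum_list is + length is))"
    by (intro finite_cartesian_product finite_positive_lists_sum_le)
qed

end

theory Submission
  imports Defs
begin

text \<open>
  The series converges absolutely. Write \<open>k\<close> and \<open>l\<close> for the numbers of indices on the two sides,
  counted with multiplicity. Everything rests on the bound
  \<open>\<bar>N\<bar> \<le> fact k * fact l * (4 * 4 ^ n) ^ (k + l)\<close> for the coefficients whose indices are at most \<open>n\<close>
  (\<open>abs_coef_N1_le\<close>). Given this bound, the factorials are absorbed by the denominators of the series: a
  multinomial coefficient with at most \<open>n\<close> lower entries is at most \<open>n ^ k\<close>. Hence each index \<open>j\<close>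
  in a term contributes at most \<open>n * j * \<bar>t\<^sub>j\<bar> * (4 * 4 ^ n)\<close>, which the hypothesis on \<open>t\<close> makes at
  most \<open>2 / e < 1\<close>, while the power of \<open>t\<^sub>0\<close> is at most \<open>1\<close>. So the series is dominated by
  a product of geometric series.

  The bound for the coefficients discards the signs and combines estimates for its three ingredients, in
  each of which the dependence on \<open>m\<close>, the number of the \<open>s\<close>'s, is kept explicit.

  \<^item> \<open>coef_T1_le\<close>: \<open>T\<^sup>1\<close> with indices \<open>i, j\<close> and \<open>m\<close> arguments is at most \<open>j ^ (m - 1) / fact m\<close>,
    independently of the \<open>s\<close>'s and of the possibly large \<open>i\<close>.

  \<^item> \<open>coef_T2_le\<close>: consequently \<open>T\<^sup>2\<close> is at most
    \<open>n ^ (m - 1) * fact (k - 2) * (k - 1) ^ m / fact m\<close>, by induction on \<open>k\<close>.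

  \<^item> \<open>coef_S_le\<close>, \<open>sum_decompositions_le\<close>: as \<open>T\<^sup>2\<close> is bounded uniformly in \<open>ss\<close>, only the sum of
    \<open>S\<close> over all \<open>ss\<close> matters, and this is a sum over ordered set partitions of the \<open>l\<close> labels,
    of size at most \<open>4 ^ i * fact l * 3 ^ l / 2 ^ m\<close>.

  The denominator \<open>fact m\<close> in the second bound makes the sum over \<open>m\<close> converge, to at most
  \<open>exp (n * (k - 1))\<close>.
\<close>

section \<open>The coefficients $T^1$\<close>

lemma sum_compositions:
  assumes "0 < m"
  shows "(\<Sum>ns\<in>compositions m. f ns) = (\<Sum>c=1..m. \<Sum>ns\<in>compositions (m - c). f (c # ns))"
proof -
  have "compositions m = (\<lambda>(c, ns). c # ns) ` (SIGMA c:{1..m}. compositions (m - c))" (is "_ = ?R")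
  proof
    show "compositions m \<subseteq> ?R"
    proof
      fix ns assume ns: "ns \<in> compositions m"
      then obtain c ns' where "ns = c # ns'" using assms by (cases ns) (auto simp: compositions_def)
      then show "ns \<in> ?R" using ns by (auto simp: compositions_def image_iff)
    qed
  qed (auto simp: compositions_def)
  moreover have "inj_on (\<lambda>(c, ns). c # ns) X" for X :: "(nat \<times> nat list) set"
    by (auto simp: inj_on_def)
  ultimately have "(\<Sum>ns\<in>compositions m. f ns) =
      (\<Sum>(c, ns)\<in>(SIGMA c:{1..m}. compositions (m - c)). f (c # ns))"
    by (simp add: sum.reindex case_prod_unfold)
  then show ?thesis by (simp add: sum.Sigma finite_compositions)
qed

lemma compositions_0: "compositions 0 = {[]}"
proof -
  have "ns = []" if "ns \<in> compositions 0" for ns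
    using that by (cases ns) (auto simp: compositions_def)
  then show ?thesis by (auto simp: compositions_def)
qed

lemma card_compositions_le: "card (compositions m) \<le> 2 ^ m"
proof (induction m rule: less_induct)
  case (less m)
  show ?case
  proof (cases "m = 0")
    case False
    have "card (compositions m) = (\<Sum>c=1..m. card (compositions (m - c)))"
      using sum_compositions[of m "\<lambda>_. 1::nat"] False by simp
    also have "\<dots> \<le> (\<Sum>c=1..m. 2 ^ (m - c))"
      by (rule sum_mono) (use less in auto)
    also have "\<dots> = (\<Sum>c<m. 2 ^ c)"
      by (rule sum.reindex_bij_witness[of _ "\<lambda>c. m - c" "\<lambda>c. m - c"]) auto
    also have "\<dots> \<le> 2 ^ m" by (simp add: sum_power2 flip: atLeast0LessThan)
    finally show ?thesis .
  qed (simp add: compositions_0)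
qed

lemma sum_binomial_exp:
  fixes x y :: real
  shows "(\<Sum>c\<le>m. x ^ c / fact c * (y ^ (m - c) / fact (m - c))) = (x + y) ^ m / fact m"
proof -
  have "(x + y) ^ m / fact m = (\<Sum>c\<le>m. real (m choose c) * x ^ c * y ^ (m - c) / fact m)"
    by (simp only: binomial_ring sum_divide_distrib)
  also have "\<dots> = (\<Sum>c\<le>m. x ^ c / fact c * (y ^ (m - c) / fact (m - c)))"
    by (rule sum.cong) (auto simp: binomial_fact field_simps)
  finally show ?thesis by simp
qed

text \<open>
  Both sides are the coefficient of \<open>x ^ m\<close> in
  \<open>exp (j * x) = (1 + (exp x - 1)) ^ j\<close>: expanding the power on the right by the binomial theorem, the
  \<open>p\<close>-th term \<open>(exp x - 1) ^ p\<close> collects the compositions with \<open>p\<close> parts. In the induction on \<open>j\<close>,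
  Pascal's rule splits off the first part of a composition.
\<close>

lemma sum_compositions_choose:
  "(\<Sum>ns\<in>compositions m. real (j choose length ns) / (\<Prod>n\<leftarrow>ns. fact n)) = real j ^ m / fact m"
proof (induction j arbitrary: m)
  case 0
  show ?case
  proof (cases "m = 0")
    case False
    then have "ns \<noteq> []" if "ns \<in> compositions m" for ns using that by (auto simp: compositions_def)
    then show ?thesis using False by (simp add: sum.neutral power_0_left)
  qed (simp add: compositions_0)
next
  case (Suc j)
  show ?case
  proof (cases "m = 0")
    case False
    let ?w = "\<lambda>ns. 1 / (\<Prod>n\<leftarrow>ns. fact n) :: real"
    have "(\<Sum>ns\<in>compositions m. real (Suc j choose length ns) / (\<Prod>n\<leftarrow>ns. fact n)) =
      (\<Sum>c=1..m. \<Sum>ns\<in>compositions (m - c). real (j choose length ns) * ?w (c # ns) + real (j choose length (c # ns)) * ?w (c # ns))"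
      using False by (subst sum_compositions) (auto simp: add_divide_distrib)
    also have "\<dots> = (\<Sum>c=1..m. 1 / fact c * (\<Sum>ns\<in>compositions (m - c). real (j choose length ns) / (\<Prod>n\<leftarrow>ns. fact n)))
        + (\<Sum>c=1..m. \<Sum>ns\<in>compositions (m - c). real (j choose length (c # ns)) * ?w (c # ns))"
      by (simp add: sum.distrib sum_distrib_left)
    also have "(\<Sum>c=1..m. \<Sum>ns\<in>compositions (m - c). real (j choose length (c # ns)) * ?w (c # ns)) = real j ^ m / fact m"
      using False by (subst Suc.IH[symmetric], subst sum_compositions) auto
    also have "(\<Sum>c=1..m. 1 / fact c * (\<Sum>ns\<in>compositions (m - c). real (j choose length ns) / (\<Prod>n\<leftarrow>ns. fact n)))
        = (\<Sum>c=1..m. 1 / fact c * (real j ^ (m - c) / fact (m - c)))"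
      by (simp only: Suc.IH)
    also have "\<dots> + real j ^ m / fact m = (\<Sum>c\<le>m. 1 / fact c * (real j ^ (m - c) / fact (m - c)))"
      by (simp add: atLeast0AtMost[symmetric] sum.atLeast_Suc_atMost[of 0 m])
    also have "\<dots> = (1 + real j) ^ m / fact m"
      using sum_binomial_exp[of 1 "real j" m] by simp
    finally show ?thesis by simp
  qed (simp add: compositions_0)
qed

lemma card_positive_lists_le:
  assumes "0 < j"
  shows "card {ys :: nat list. length ys = p \<and> sum_list ys = j \<and> (\<forall>y\<in>set ys. 1 \<le> y)} \<le> (j - 1) choose (p - 1)"
proof (cases "p = 0")
  case False
  define Y where "Y = {ys :: nat list. length ys = p \<and> sum_list ys = j \<and> (\<forall>y\<in>set ys. 1 \<le> y)}"
  have len: "p \<le> j" if "ys \<in> Y" for ys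
  proof -
    have "(\<forall>y\<in>set ys. 1 \<le> y) \<Longrightarrow> length ys \<le> sum_list ys" by (induction ys) auto
    then show ?thesis using that by (auto simp: Y_def)
  qed
  show ?thesis
  proof (cases "Y = {}")
    case True
    then have "card Y = 0" by simp
    then show ?thesis unfolding Y_def by (simp only: zero_le)
  next
    case ne: False
    then have "p \<le> j" using len by blast
    have s: "sum_list (map (\<lambda>y. y - 1) ys) + length ys = sum_list ys" if "\<forall>y\<in>set ys. 1 \<le> y" for ys :: "nat list"
      using that by (induction ys) auto
    have "card Y = card (map (\<lambda>y. y - 1) ` Y)"
    proof (rule card_image[symmetric], rule inj_onI)
      fix xs ys assume "xs \<in> Y" "ys \<in> Y" "map (\<lambda>y. y - 1) xs = map (\<lambda>y. y - 1) ys"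
      moreover have "map Suc (map (\<lambda>y. y - 1) zs) = zs" if "zs \<in> Y" for zs
        using that by (auto simp: Y_def comp_def Suc_le_eq intro!: map_idI)
      ultimately show "xs = ys" by (metis (no_types))
    qed
    also have "\<dots> \<le> card {l :: nat list. length l = p \<and> sum_list l = j - p}"
    proof (rule card_mono)
      show "finite {l :: nat list. length l = p \<and> sum_list l = j - p}"
        by (rule finite_subset[OF _ finite_lists_length_eq[of "{..j - p}" p]])
           (auto dest: member_le_sum_list)
      show "map (\<lambda>y. y - 1) ` Y \<subseteq> {l. length l = p \<and> sum_list l = j - p}"
      proof safe
        fix ys assume ys: "ys \<in> Y"
        then show "length (map (\<lambda>y. y - 1) ys) = p" by (simp add: Y_def)
        show "sum_list (map (\<lambda>y. y - 1) ys) = j - p" using s[of ys] ys by (auto simp: Y_def)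
      qed
    qed
    also have "\<dots> = (j - p + p - 1) choose (j - p)" by (rule card_length_sum_list)
    also have "\<dots> = (j - 1) choose (p - 1)"
      using \<open>p \<le> j\<close> False binomial_symmetric[of "p - 1" "j - 1"] by (simp add: Suc_diff_le)
    finally show ?thesis by (simp add: Y_def)
  qed
next
  case True
  have "{ys :: nat list. length ys = p \<and> sum_list ys = j \<and> (\<forall>y\<in>set ys. 1 \<le> y)} = {}"
    using True assms by auto
  then show ?thesis by (simp only: card.empty zero_le)
qed

text \<open>
  The complement \<open>x \<mapsto> s - x\<close> of each entry turns a tuple with sum \<open>i\<close> into a tuple of positive
  numbers with sum \<open>j\<close>. Bounding by \<open>j\<close> and not by \<open>i\<close> is essential: later \<open>j\<close> is one of the given
  indices, hence at most \<open>n\<close>, whereas \<open>i\<close> can be arbitrarily large.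
\<close>

lemma coef_P_le:
  assumes "0 < j" "sum_list ss = i + j"
  shows "coef_P i j' ss \<le> (j - 1) choose (length ss - 1)"
proof -
  let ?X = "{xs. length xs = length ss \<and> sum_list xs = i \<and> (\<forall>r<length ss. 1 \<le> xs ! r \<and> xs ! r \<le> ss ! r - 1)}"
  let ?Y = "{ys :: nat list. length ys = length ss \<and> sum_list ys = j \<and> (\<forall>y\<in>set ys. 1 \<le> y)}"
  let ?c = "map2 (\<lambda>s x. s - x :: nat) ss"
  have "card ?X \<le> card ?Y"
  proof (rule card_inj_on_le)
    show "inj_on ?c ?X"
    proof (rule inj_onI, rule nth_equalityI)
      fix xs ys r assume *: "xs \<in> ?X" "ys \<in> ?X" "?c xs = ?c ys" "r < length xs"
      from *(3) have "?c xs ! r = ?c ys ! r" by simp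
      with *(1,2,4) have "ss ! r - xs ! r = ss ! r - ys ! r" by simp
      moreover have "1 \<le> xs ! r" "xs ! r \<le> ss ! r - 1" "1 \<le> ys ! r" "ys ! r \<le> ss ! r - 1" using * by auto
      ultimately show "xs ! r = ys ! r" by linarith
    qed auto
    show "?c ` ?X \<subseteq> ?Y"
    proof safe
      fix xs y assume *: "length xs = length ss" "i = sum_list xs"
        "\<forall>r<length ss. 1 \<le> xs ! r \<and> xs ! r \<le> ss ! r - 1"
      then have le: "xs ! r < ss ! r" if "r < length ss" for r using that by fastforce
      have "sum_list (?c xs) = (\<Sum>r<length ss. ss ! r - xs ! r)"
        using * by (simp add: sum_list_sum_nth atLeast0LessThan)
      also have "\<dots> = sum_list ss - sum_list xs"
        using le *(1) by (subst sum_subtractf_nat) (auto simp: sum_list_sum_nth atLeast0LessThan less_imp_le)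
      finally show "sum_list (?c xs) = j" using assms * by simp
      show "1 \<le> y" if "y \<in> set (?c xs)"
        using that le *(1) by (auto simp: in_set_conv_nth Suc_le_eq)
      show "length (?c xs) = length ss" using *(1) by simp
    qed
    show "finite ?Y"
      by (rule finite_subset[OF _ finite_positive_lists_sum_le[of j]]) auto
  qed
  also have "\<dots> \<le> (j - 1) choose (length ss - 1)" by (rule card_positive_lists_le) fact
  finally show ?thesis by (simp add: coef_P_def)
qed

lemma length_block_sums [simp]: "length (block_sums ns ss) = length ns"
  by (induction ns arbitrary: ss) auto

lemma sum_list_block_sums:
  "sum_list ns = length ss \<Longrightarrow> sum_list (block_sums ns ss) = sum_list ss"
proof (induction ns arbitrary: ss)
  case (Cons n ns)
  then have "sum_list (block_sums ns (drop n ss)) = sum_list (drop n ss)" by simp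
  then show ?case by (simp flip: sum_list_append)
qed simp

lemma coef_T1_nonneg: "0 \<le> coef_T1 i j ss"
  unfolding coef_T1_def by (intro sum_nonneg mult_nonneg_nonneg divide_nonneg_nonneg prod_list_nonneg) auto

text \<open>
  Absorbing the weight \<open>1 / p\<close> of a composition with \<open>p\<close> parts into the binomial coefficient by
  \<open>(j - 1 choose p - 1) / p = (j choose p) / j\<close> makes the bound for \<open>coef_P\<close> summable in closed form.
\<close>

lemma coef_T1_le:
  assumes "0 < j" "sum_list ss = i + j"
  shows "coef_T1 i j ss \<le> real j ^ (length ss - 1) / fact (length ss)"
proof -
  let ?m = "length ss"
  have m: "0 < ?m" using assms by (cases ss) auto
  have "coef_T1 i j ss \<le> (\<Sum>ns\<in>compositions ?m. (real (j choose length ns) / (\<Prod>n\<leftarrow>ns. fact n)) / real j)"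
    unfolding coef_T1_def
  proof (rule sum_mono)
    fix ns assume ns: "ns \<in> compositions ?m"
    have pos: "0 < (\<Prod>n\<leftarrow>ns. fact n :: real)" by (induction ns) auto
    obtain p where p: "length ns = Suc p" using ns m by (cases ns) (auto simp: compositions_def)
    obtain j' where j': "j = Suc j'" using assms(1) by (cases j) auto
    have "coef_P i j (block_sums ns ss) \<le> (j - 1) choose (length ns - 1)"
      using coef_P_le[of j "block_sums ns ss" i j] ns assms
      by (simp add: sum_list_block_sums compositions_def)
    then have "1 / (real (length ns) * (\<Prod>n\<leftarrow>ns. fact n)) * real (coef_P i j (block_sums ns ss))
      \<le> 1 / (real (length ns) * (\<Prod>n\<leftarrow>ns. fact n)) * real ((j - 1) choose (length ns - 1))"
      using pos by (intro mult_left_mono) auto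
    also have "real (Suc j' choose Suc p) * real (Suc p) = real (Suc j') * real (j' choose p)"
      by (metis Suc_times_binomial_eq of_nat_mult)
    then have "1 / (real (length ns) * (\<Prod>n\<leftarrow>ns. fact n)) * real ((j - 1) choose (length ns - 1))
      = (real (j choose length ns) / (\<Prod>n\<leftarrow>ns. fact n)) / real j"
      using pos unfolding p j' by (simp add: divide_simps)
    finally show "1 / (real (length ns) * (\<Prod>n\<leftarrow>ns. fact n)) * real (coef_P i j (block_sums ns ss))
      \<le> (real (j choose length ns) / (\<Prod>n\<leftarrow>ns. fact n)) / real j" .
  qed
  also have "\<dots> = real j ^ ?m / fact ?m / real j"
    by (simp only: sum_divide_distrib[symmetric] sum_compositions_choose)
  also have "\<dots> = real j ^ (?m - 1) / fact ?m"
    using m assms(1) by (cases ?m) (simp_all del: fact_Suc)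
  finally show ?thesis .
qed

section \<open>The coefficients $T^2$\<close>

text \<open>
  Each index lies in at most \<open>c\<close> of the windows of length \<open>c\<close>.
\<close>

lemma sum_windows_le:
  fixes f :: "nat \<Rightarrow> nat"
  assumes "c \<le> m"
  shows "(\<Sum>a\<le>m - c. \<Sum>q<c. f (a + q)) \<le> c * (\<Sum>r<m. f r)"
proof -
  have "(\<Sum>a\<le>m - c. f (a + q)) \<le> (\<Sum>r<m. f r)" if "q < c" for q
  proof -
    have "(\<Sum>a\<le>m - c. f (a + q)) = (\<Sum>r\<in>(\<lambda>a. a + q) ` {..m - c}. f r)"
      by (subst sum.reindex) (auto simp: inj_on_def)
    also have "\<dots> \<le> (\<Sum>r<m. f r)"
      using that assms by (intro sum_mono2) auto
    finally show ?thesis .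
  qed
  then have "(\<Sum>q<c. \<Sum>a\<le>m - c. f (a + q)) \<le> (\<Sum>q<c. \<Sum>r<m. f r)"
    by (intro sum_mono) auto
  then show ?thesis by (subst sum.swap) simp
qed

lemma coef_T2_nonneg: "0 \<le> coef_T2 is ss ls"
proof (induction "is" ss ls rule: coef_T2.induct)
  case (1 "is" ss ls)
  show ?case
  proof -
    have "0 \<le> (\<Sum>(a, b) \<in> {(a, b). a \<le> b \<and> b < length ss \<and>
                     last is < sum_list (slice a b ss) \<and> 1 \<le> merged_l a b ls}.
          real (merged_l a b ls) *
          coef_T1 (sum_list (slice a b ss) - last is) (last is) (slice a b ss) *
          coef_T2 (butlast is)
            (replace_slice a b (sum_list (slice a b ss) - last is) ss)
            (replace_slice a b (merged_l a b ls) ls))"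
      if "\<not> length is \<le> 1" "length is \<noteq> 2"
      using 1[OF that] by (intro sum_nonneg) (auto intro!: mult_nonneg_nonneg coef_T1_nonneg)
    then show ?thesis by (subst coef_T2.simps) (simp add: coef_T1_nonneg)
  qed
qed

lemma sum_list_replace_slice:
  assumes "a \<le> b" "b < length xs"
  shows "sum_list (replace_slice a b x xs) + sum_list (slice a b xs) = sum_list xs + (x :: nat)"
proof -
  have "xs = take a xs @ slice a b xs @ drop (b + 1) xs"
    using assms by (simp add: slice_def) (metis append_take_drop_id drop_drop le_add_diff_inverse le_Suc_eq add.commute)
  then have "sum_list xs = sum_list (take a xs) + sum_list (slice a b xs) + sum_list (drop (b + 1) xs)"
    by (metis sum_list_append add.assoc)
  then show ?thesis by (simp add: replace_slice_def)
qed

lemma length_slice: "b < length xs \<Longrightarrow> length (slice a b xs) = b + 1 - a"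
  by (auto simp: slice_def)

lemma length_replace_slice:
  "a \<le> b \<Longrightarrow> b < length xs \<Longrightarrow> length (replace_slice a b x xs) = length xs - (b - a)"
  by (auto simp: replace_slice_def)

lemma map_replace_slice: "map f (replace_slice a b x xs) = replace_slice a b (f x) (map f xs)"
  by (simp add: replace_slice_def take_map drop_map)

lemma map_slice: "map f (slice a b xs) = slice a b (map f xs)"
  by (simp add: slice_def take_map drop_map)

lemma merged_l_eq_sum:
  assumes "0 < c" "a + c \<le> length ls"
  shows "merged_l a (a + c - 1) ls = (\<Sum>q<c. ls ! (a + q) - 1)"
  using assms by (simp add: merged_l_def slice_def sum_list_sum_nth atLeast0LessThan)

text \<open>
  The merging steps are ordered by the length \<open>c\<close> of the merged slice, because the bounds for the
  two factors of a merging step depend on \<open>c\<close> alone.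
\<close>

lemma sum_slices:
  fixes f :: "nat \<Rightarrow> nat \<Rightarrow> 'a :: comm_monoid_add"
  shows "(\<Sum>(a, b) | a \<le> b \<and> b < m. f a b) = (\<Sum>c=1..m. \<Sum>a\<le>m - c. f a (a + c - 1))"
proof -
  have "(\<Sum>(a, b) | a \<le> b \<and> b < m. f a b) = (\<Sum>(c, a)\<in>(SIGMA c:{1..m}. {..m - c}). f a (a + c - 1))"
    by (rule sum.reindex_bij_witness[of _ "\<lambda>(c, a). (a, a + c - 1)" "\<lambda>(a, b). (b + 1 - a, a)"]) auto
  then show ?thesis by (simp add: sum.Sigma)
qed

text \<open>
  The right-hand side comes from the recursion for \<open>coef_T2\<close> itself. A merging step of a slice of
  length \<open>c\<close> contributes \<open>n ^ (c - 1) / fact c\<close> and shortens the list by \<open>c - 1\<close>, so the powers of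
  \<open>n\<close> always multiply up to \<open>n ^ (m - 1)\<close>. The factors \<open>l\<close> of the slices of length \<open>c\<close> add
  up to at most \<open>c * (k - 2)\<close>, which cancels one factor of \<open>fact c\<close>. What remains is the recursion
  \<open>G_k(x) = (k - 2) * exp x * G_{k-1}(x)\<close> for exponential generating functions, and the
  solution with \<open>G_2(x) = exp x\<close> is \<open>fact (k - 2) * exp ((k - 1) * x)\<close>.
\<close>

lemma coef_T2_le:
  assumes "length is = k" "2 \<le> k" "\<forall>i\<in>set is. 1 \<le> i \<and> i \<le> n"
    and "length ss = m" "length ls = m" "0 < m"
    and "sum_list ss = sum_list is" "(\<Sum>l\<leftarrow>ls. l - 1) = k - 2"
  shows "coef_T2 is ss ls \<le> real n ^ (m - 1) * fact (k - 2) * real (k - 1) ^ m / fact m"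
  using assms
proof (induction k arbitrary: "is" ss ls m rule: less_induct)
  case (less k)
  have T1: "coef_T1 (sum_list zs - j) j zs \<le> real n ^ (length zs - 1) / fact (length zs)"
    if "j \<in> set is" "j \<le> sum_list zs" for j zs
  proof -
    have "coef_T1 (sum_list zs - j) j zs \<le> real j ^ (length zs - 1) / fact (length zs)"
      using that less.prems(3) by (intro coef_T1_le) auto
    also have "\<dots> \<le> real n ^ (length zs - 1) / fact (length zs)"
      using that less.prems(3) by (intro divide_right_mono power_mono) auto
    finally show ?thesis .
  qed
  show ?case
  proof (cases "k = 2")
    case True
    then obtain i j where ij: "is = [i, j]"
      using less.prems(1) by (metis One_nat_def Suc_1 length_0_conv length_Suc_conv)
    have "coef_T2 is ss ls \<le> max 0 (coef_T1 (sum_list ss - j) j ss)"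
      using less.prems ij by (subst coef_T2.simps) auto
    also have "\<dots> \<le> real n ^ (m - 1) / fact m"
      using T1[of j ss] less.prems ij by auto
    finally show ?thesis using True by simp
  next
    case False
    then have k: "3 \<le> k" using less.prems by simp
    then have isne: "is \<noteq> []" using less.prems by auto
    \<comment> \<open>the common bound for the product of the two coefficients over slices of length \<open>c\<close>\<close>
    define B where "B = (\<lambda>c. real n ^ (m - 1) * fact (k - 3) * real (k - 2) ^ (m - c + 1) / (fact c * fact (m - c + 1)))"
    define X where "X = {(a, b). a \<le> b \<and> b < length ss \<and>
                     last is < sum_list (slice a b ss) \<and> 1 \<le> merged_l a b ls}"
    have "coef_T2 is ss ls = (\<Sum>(a, b) \<in> X.
          real (merged_l a b ls) *
          coef_T1 (sum_list (slice a b ss) - last is) (last is) (slice a b ss) *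
          coef_T2 (butlast is)
            (replace_slice a b (sum_list (slice a b ss) - last is) ss)
            (replace_slice a b (merged_l a b ls) ls))"
      using k less.prems(1) by (subst coef_T2.simps) (simp add: X_def)
    also have "\<dots> \<le> (\<Sum>(a, b) \<in> X. real (merged_l a b ls) * B (b + 1 - a))"
    proof (rule sum_mono, clarify)
      fix a b assume "(a, b) \<in> X"
      then have ab: "a \<le> b" "b < length ss" "last is < sum_list (slice a b ss)" "1 \<le> merged_l a b ls"
        by (auto simp: X_def)
      let ?s = "sum_list (slice a b ss) - last is"
      let ?l = "merged_l a b ls"
      let ?ss = "replace_slice a b ?s ss"
      let ?ls = "replace_slice a b ?l ls"
      let ?c = "b + 1 - a"
      have len: "length (slice a b ss) = ?c" using ab by (simp add: length_slice)
      have t1: "coef_T1 ?s (last is) (slice a b ss) \<le> real n ^ (?c - 1) / fact ?c"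
        using T1[of "last is" "slice a b ss"] ab isne len by simp
      have is_sum: "sum_list (butlast is) + last is = sum_list is"
        using isne by (metis append_butlast_last_id sum_list_append add_0_right sum_list.Cons sum_list.Nil)
      have t2: "coef_T2 (butlast is) ?ss ?ls \<le>
        real n ^ (m - ?c + 1 - 1) * fact (k - 1 - 2) * real (k - 1 - 1) ^ (m - ?c + 1) / fact (m - ?c + 1)"
      proof (rule less.IH)
        show "\<forall>i\<in>set (butlast is). 1 \<le> i \<and> i \<le> n" using less.prems(3) in_set_butlastD by metis
        show "sum_list ?ss = sum_list (butlast is)"
          using sum_list_replace_slice[of a b ss ?s] ab is_sum less.prems(7) by linarith
        show "length ?ss = m - ?c + 1" "length ?ls = m - ?c + 1"
          using ab less.prems(4,5) by (auto simp: length_replace_slice)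
        have "(\<Sum>l\<leftarrow>?ls. l - 1) + ?l = (\<Sum>l\<leftarrow>ls. l - 1) + (?l - 1)"
          using sum_list_replace_slice[of a b "map (\<lambda>l. l - 1) ls" "?l - 1"] ab less.prems(4,5)
          by (simp add: map_replace_slice merged_l_def map_slice)
        then show "(\<Sum>l\<leftarrow>?ls. l - 1) = k - 1 - 2" using ab less.prems(8) k by linarith
      qed (use k less.prems(1) in auto)
      have e: "k - 1 - 2 = k - 3" "k - 1 - 1 = k - 2" by simp_all
      have "coef_T1 ?s (last is) (slice a b ss) * coef_T2 (butlast is) ?ss ?ls \<le>
        (real n ^ (?c - 1) / fact ?c) *
        (real n ^ (m - ?c + 1 - 1) * fact (k - 1 - 2) * real (k - 1 - 1) ^ (m - ?c + 1) / fact (m - ?c + 1))"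
        by (intro mult_mono t1 t2 coef_T2_nonneg) auto
      also have "\<dots> = real n ^ ((?c - 1) + (m - ?c)) * fact (k - 3) * real (k - 2) ^ (m - ?c + 1) / (fact ?c * fact (m - ?c + 1))"
        unfolding e by (simp add: power_add)
      also have "(?c - 1) + (m - ?c) = m - 1" using ab less.prems(4) by auto
      finally show "real ?l * coef_T1 ?s (last is) (slice a b ss) * coef_T2 (butlast is) ?ss ?ls \<le> real ?l * B ?c"
        unfolding B_def mult.assoc by (intro mult_left_mono) (auto simp: mult.assoc)
    qed
    also have "\<dots> \<le> (\<Sum>(a, b) | a \<le> b \<and> b < m. real (merged_l a b ls) * B (b + 1 - a))"
      by (rule sum_mono2) (use finite_coef_T2_range[of m "\<lambda>_ _. True"] less.prems(4) in \<open>auto simp: X_def B_def\<close>)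
    also have "\<dots> = (\<Sum>c=1..m. \<Sum>a\<le>m - c. real (\<Sum>q<c. ls ! (a + q) - 1) * B c)"
      unfolding sum_slices using less.prems(5)
      by (intro sum.cong refl) (subst merged_l_eq_sum, auto)
    also have "\<dots> = (\<Sum>c=1..m. B c * real (\<Sum>a\<le>m - c. \<Sum>q<c. ls ! (a + q) - 1))"
      by (simp add: sum_distrib_left mult.commute)
    also have "\<dots> \<le> (\<Sum>c=1..m. B c * real (c * (k - 2)))"
    proof (intro sum_mono mult_left_mono of_nat_mono)
      fix c assume "c \<in> {1..m}"
      moreover have "(\<Sum>r<m. ls ! r - 1) = k - 2"
        using less.prems(5,8) by (simp add: sum_list_sum_nth atLeast0LessThan)
      ultimately show "(\<Sum>a\<le>m - c. \<Sum>q<c. ls ! (a + q) - 1) \<le> c * (k - 2)"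
        using sum_windows_le[of c m "\<lambda>r. ls ! r - 1"] by simp
    qed (simp add: B_def)
    also have "\<dots> = (\<Sum>c=1..m. real n ^ (m - 1) * fact (k - 2) * (1 / fact (c - 1) * (real (k - 2) ^ (m - (c - 1)) / fact (m - (c - 1)))))"
    proof (rule sum.cong)
      fix c assume "c \<in> {1..m}"
      then obtain d where d: "c = Suc d" "d < m" by (cases c) auto
      have "fact (k - 2) = real (k - 2) * fact (k - 3)"
        using k by (metis Suc_diff_Suc diff_Suc_1 fact_Suc numeral_2_eq_2 numeral_3_eq_3 of_nat_fact of_nat_mult less_eq_Suc_le)
      moreover have "B c = real n ^ (m - 1) * fact (k - 3) * real (k - 2) ^ (m - d) / (real (Suc d) * fact d * fact (m - d))"
      proof -
        have "m - Suc d + 1 = m - d" "fact (Suc d) = real (Suc d) * fact d" using d(2) by simp_all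
        then show ?thesis unfolding B_def d(1) by (simp only:)
      qed
      moreover have "c - 1 = d" using d by simp
      ultimately show "B c * real (c * (k - 2)) = real n ^ (m - 1) * fact (k - 2) * (1 / fact (c - 1) * (real (k - 2) ^ (m - (c - 1)) / fact (m - (c - 1))))"
        unfolding d(1) of_nat_mult by (simp only: times_divide_eq_left times_divide_eq_right)
          (simp add: divide_simps del: of_nat_Suc of_nat_diff)
    qed simp
    also have "\<dots> = (\<Sum>d<m. real n ^ (m - 1) * fact (k - 2) * (1 ^ d / fact d * (real (k - 2) ^ (m - d) / fact (m - d))))"
      by (rule sum.reindex_bij_witness[of _ Suc "\<lambda>c. c - 1"]) auto
    also have "\<dots> \<le> (\<Sum>d\<le>m. real n ^ (m - 1) * fact (k - 2) * (1 ^ d / fact d * (real (k - 2) ^ (m - d) / fact (m - d))))"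
      by (rule sum_mono2) auto
    also have "\<dots> = real n ^ (m - 1) * fact (k - 2) * ((1 + real (k - 2)) ^ m / fact m)"
      by (simp only: sum_distrib_left[symmetric] sum_binomial_exp)
    also have "1 + real (k - 2) = real (k - 1)" using k by simp
    finally show ?thesis by (simp only: times_divide_eq_right mult.assoc)
  qed
qed

section \<open>The coefficients $S$\<close>

text \<open>
  The decompositions for all tuples \<open>ss\<close> of a given length at once: a partition of the labels
  determines the sums of its blocks.
\<close>

definition ordered_partitions :: "'a set \<Rightarrow> nat \<Rightarrow> (nat \<Rightarrow> 'a set) set" where
  "ordered_partitions K m = {A \<in> {..<m} \<rightarrow>\<^sub>E Pow K.
     disjoint_family_on A {..<m} \<and> (\<Union>r<m. A r) = K \<and> (\<forall>r<m. A r \<noteq> {})}"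

lemma finite_ordered_partitions: "finite K \<Longrightarrow> finite (ordered_partitions K m)"
  by (rule finite_subset[of _ "{..<m} \<rightarrow>\<^sub>E Pow K"])
    (auto simp: ordered_partitions_def intro!: finite_PiE)

lemma sum_Pow_card:
  assumes "finite K"
  shows "(\<Sum>B\<in>Pow K. g (card B)) = (\<Sum>c\<le>card K. real (card K choose c) * g c)"
proof -
  have "(\<Sum>B\<in>Pow K. g (card B)) = (\<Sum>c\<le>card K. \<Sum>B\<in>{B \<in> Pow K. card B = c}. g (card B))"
    using assms by (intro sum.group[symmetric]) (auto intro: card_mono)
  also have "\<dots> = (\<Sum>c\<le>card K. \<Sum>B\<in>{B. B \<subseteq> K \<and> card B = c}. g c)"
    by (intro sum.cong) auto
  also have "\<dots> = (\<Sum>c\<le>card K. real (card K choose c) * g c)"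
    using assms by (simp add: n_subsets)
  finally show ?thesis .
qed

lemma sum_ordered_partitions_Suc_le:
  fixes f :: "'a set \<Rightarrow> real"
  assumes "finite K" "\<And>B. 0 \<le> f B"
  shows "(\<Sum>A\<in>ordered_partitions K (Suc m). \<Prod>r<Suc m. f (A r)) \<le>
    (\<Sum>B\<in>Pow K - {{}}. f B * (\<Sum>A\<in>ordered_partitions (K - B) m. \<Prod>r<m. f (A r)))"
proof -
  let ?h = "\<lambda>A :: nat \<Rightarrow> 'a set. (A m, restrict A {..<m})"
  let ?S = "SIGMA B:Pow K - {{}}. ordered_partitions (K - B) m"
  have inj: "inj_on ?h (ordered_partitions K (Suc m))"
  proof (rule inj_onI)
    fix A A' assume *: "A \<in> ordered_partitions K (Suc m)" "A' \<in> ordered_partitions K (Suc m)" "?h A = ?h A'"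
    have "A r = A' r" if "r < m" for r
      using * that by (metis lessThan_iff prod.inject restrict_apply')
    moreover have "A m = A' m" using * by simp
    moreover have "A r = A' r" if "\<not> r < Suc m" for r
      using * that by (auto simp: ordered_partitions_def PiE_def extensional_def)
    ultimately show "A = A'" by (metis ext less_Suc_eq)
  qed
  have img: "?h ` ordered_partitions K (Suc m) \<subseteq> ?S"
  proof
    fix x assume "x \<in> ?h ` ordered_partitions K (Suc m)"
    then obtain A where A: "A \<in> ordered_partitions K (Suc m)" "x = ?h A" by blast
    have dis: "disjoint_family_on A {..<Suc m}" using A by (auto simp: ordered_partitions_def)
    have d: "A r \<inter> A m = {}" if "r < m" for r
      using dis that by (auto simp: disjoint_family_on_def)
    have u: "(\<Union>r<m. A r) \<union> A m = K" using A by (auto simp: ordered_partitions_def lessThan_Suc)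
    have "disjoint_family_on (restrict A {..<m}) {..<m}"
      using dis by (auto simp: disjoint_family_on_def)
    moreover have "(\<Union>r<m. A r) = K - A m" using u d by blast
    moreover have "A r \<noteq> {}" if "r \<le> m" for r
      using A that by (auto simp: ordered_partitions_def)
    ultimately have "restrict A {..<m} \<in> ordered_partitions (K - A m) m"
      by (auto simp: ordered_partitions_def)
    then show "x \<in> ?S" using A u \<open>\<And>r. r \<le> m \<Longrightarrow> A r \<noteq> {}\<close> by auto
  qed
  have "(\<Sum>A\<in>ordered_partitions K (Suc m). \<Prod>r<Suc m. f (A r)) =
     (\<Sum>(B, A)\<in>?h ` ordered_partitions K (Suc m). f B * (\<Prod>r<m. f (A r)))"
    by (subst sum.reindex[OF inj]) (simp add: mult.commute)
  also have "\<dots> \<le> (\<Sum>(B, A)\<in>?S. f B * (\<Prod>r<m. f (A r)))"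
    using assms img by (intro sum_mono2)
      (auto intro!: finite_SigmaI finite_ordered_partitions mult_nonneg_nonneg prod_nonneg)
  also have "\<dots> = (\<Sum>B\<in>Pow K - {{}}. f B * (\<Sum>A\<in>ordered_partitions (K - B) m. \<Prod>r<m. f (A r)))"
    using assms(1) by (subst sum.Sigma[symmetric]) (auto simp: finite_ordered_partitions sum_distrib_left)
  finally show ?thesis .
qed

lemma two_sum_powers_of_three: "2 * (\<Sum>c<N. 3 ^ c) = (3 ^ N - 1 :: real)"
  by (induction N) auto

text \<open>
  Ordering the labels within each block turns the sum into a count of the ways to arrange \<open>K\<close> in a row
  and to cut the row into \<open>m\<close> nonempty pieces. There are \<open>fact (card K)\<close> arrangements, and giving
  every piece the weight \<open>2\<close> makes the cuts contribute at most \<open>(1 + 2) ^ card K\<close>. The weight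
  \<open>2 ^ m\<close> compensates the number of tuples \<open>ls\<close> that occur with a given \<open>m\<close>.
\<close>

lemma sum_ordered_partitions_fact_le:
  assumes "finite K"
  shows "2 ^ m * (\<Sum>A\<in>ordered_partitions K m. \<Prod>r<m. fact (card (A r)) :: real)
    \<le> fact (card K) * 3 ^ card K"
  using assms
proof (induction m arbitrary: K)
  case 0
  have "ordered_partitions K 0 \<subseteq> {\<lambda>_. undefined}" by (auto simp: ordered_partitions_def)
  then have "card (ordered_partitions K 0) \<le> 1" using card_mono[of "{\<lambda>_. undefined}" "ordered_partitions K 0"] by simp
  then have "(\<Sum>A\<in>ordered_partitions K 0. \<Prod>r<0. fact (card (A r)) :: real) \<le> 1" by simp
  also have "1 \<le> (fact (card K) * 3 ^ card K :: real)"
    using mult_mono[of 1 "fact (card K) :: real" 1 "3 ^ card K"] by simp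
  finally show ?case by simp
next
  case (Suc m)
  let ?N = "card K"
  let ?W = "\<lambda>K m. \<Sum>A\<in>ordered_partitions K m. \<Prod>r<m. fact (card (A r)) :: real"
  let ?g = "\<lambda>c. if c = 0 then 0 else fact c * (fact (?N - c) * 3 ^ (?N - c)) :: real"
  have "2 ^ Suc m * ?W K (Suc m) \<le> 2 ^ Suc m * (\<Sum>B\<in>Pow K - {{}}. fact (card B) * ?W (K - B) m)"
    using sum_ordered_partitions_Suc_le[of K "\<lambda>B. fact (card B)" m] Suc.prems by (intro mult_left_mono) auto
  also have "\<dots> = 2 * (\<Sum>B\<in>Pow K - {{}}. fact (card B) * (2 ^ m * ?W (K - B) m))"
    by (simp add: sum_distrib_left mult_ac)
  also have "\<dots> \<le> 2 * (\<Sum>B\<in>Pow K - {{}}. ?g (card B))"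
  proof (intro mult_left_mono sum_mono)
    fix B assume B: "B \<in> Pow K - {{}}"
    then have "finite B" "card B \<noteq> 0" "card (K - B) = ?N - card B"
      using Suc.prems by (auto simp: card_Diff_subset finite_subset)
    then show "fact (card B) * (2 ^ m * ?W (K - B) m) \<le> ?g (card B)"
      using Suc.IH[of "K - B"] Suc.prems by simp
  qed auto
  also have "(\<Sum>B\<in>Pow K - {{}}. ?g (card B)) = (\<Sum>B\<in>Pow K. ?g (card B))"
    using Suc.prems by (intro sum.mono_neutral_left) auto
  also have "\<dots> = (\<Sum>c\<le>?N. real (?N choose c) * ?g c)"
    by (rule sum_Pow_card) fact
  also have "\<dots> = (\<Sum>c\<in>{1..?N}. fact ?N * 3 ^ (?N - c))"
  proof (rule sum.mono_neutral_cong_right)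
    fix c assume "c \<in> {1..?N}"
    then show "real (?N choose c) * ?g c = fact ?N * 3 ^ (?N - c)"
      by (simp add: binomial_fact)
  qed auto
  also have "\<dots> = fact ?N * (\<Sum>c<?N. 3 ^ c)"
    unfolding sum_distrib_left
    by (rule sum.reindex_bij_witness[of _ "\<lambda>c. ?N - c" "\<lambda>c. ?N - c"]) auto
  also have "2 * (fact ?N * (\<Sum>c<?N. 3 ^ c)) = fact ?N * (3 ^ ?N - 1 :: real)"
    using two_sum_powers_of_three[of ?N] by (simp add: mult.left_commute)
  also have "\<dots> \<le> fact ?N * 3 ^ ?N" by (intro mult_left_mono) auto
  finally show ?case .
qed

lemma real_binomial_le_power2:
  assumes "a \<le> s"
  shows "real (a choose b) \<le> 2 ^ s"
proof -
  have "real (a choose b) \<le> real (2 ^ a)" using binomial_le_pow2 of_nat_mono by blast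
  also have "\<dots> \<le> 2 ^ s" using assms by (simp add: power_increasing)
  finally show ?thesis .
qed

text \<open>
  With \<open>p = l - 1\<close>, \<open>q = c - 1\<close> and \<open>u = s + 1 - (c + l)\<close>, which add up to \<open>s - 1\<close>, the quotient is
  a trinomial coefficient times \<open>fact q\<close>.
\<close>

lemma fact_quotient_le:
  assumes "1 \<le> c" "1 \<le> l" "c + l \<le> s + 1"
  shows "fact (s - 1) / (fact (s + 1 - (c + l)) * fact (l - 1)) \<le> (4 ^ s * fact c :: real)"
proof -
  define p q u where "p = l - 1" "q = c - 1" "u = s + 1 - (c + l)"
  have eq: "s - 1 = p + (q + u)" "p + (q + u) \<le> s" using assms by (auto simp: p_q_u_def)
  have b: "real (p + (q + u) choose p) = fact (p + (q + u)) / (fact p * fact (q + u))"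
    "real (q + u choose q) = fact (q + u) / (fact q * fact u)"
    by (simp_all add: binomial_fact)
  have "fact (s - 1) / (fact u * fact p) = real (p + (q + u) choose p) * real (q + u choose q) * fact q"
    unfolding eq b by simp
  also have "\<dots> \<le> 2 ^ s * 2 ^ s * fact c"
  proof (intro mult_mono)
    show "real (p + (q + u) choose p) \<le> 2 ^ s" by (rule real_binomial_le_power2) fact
    show "real (q + u choose q) \<le> 2 ^ s" by (rule real_binomial_le_power2) (use eq(2) in simp)
    show "fact q \<le> (fact c :: real)" by (rule fact_mono) (simp add: p_q_u_def)
  qed auto
  also have "2 ^ s * 2 ^ s = (4 ^ s :: real)" by (simp flip: power_mult_distrib)
  finally show ?thesis by (simp add: p_q_u_def)
qed

lemma coef_S_nonneg: "0 \<le> coef_S js ss ls"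
  unfolding coef_S_def by (intro sum_nonneg prod_nonneg) auto

lemma decompositions_nonempty:
  assumes "A \<in> decompositions js ss" "\<forall>s\<in>set ss. 1 \<le> s" "r < length ss"
  shows "A r \<noteq> {}"
proof
  assume "A r = {}"
  moreover have "(\<Sum>q\<in>A r. js ! q) = ss ! r" using assms by (auto simp: decompositions_def)
  ultimately show False using assms(2,3) nth_mem[of r ss] by fastforce
qed

lemma coef_S_le:
  assumes "length ls = length ss" "\<forall>s\<in>set ss. 1 \<le> s" "\<forall>l\<in>set ls. 1 \<le> l"
  shows "coef_S js ss ls \<le> 4 ^ sum_list ss * (\<Sum>A\<in>decompositions js ss. \<Prod>r<length ss. fact (card (A r)))"
proof -
  let ?D = "{A \<in> decompositions js ss. \<forall>r<length ss. card (A r) + ls ! r \<le> ss ! r + 1}"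
  have "coef_S js ss ls \<le> (\<Sum>A\<in>?D. \<Prod>r<length ss. 4 ^ (ss ! r) * fact (card (A r)))"
    unfolding coef_S_def
  proof (intro sum_mono prod_mono conjI)
    fix A r assume *: "A \<in> ?D" "r \<in> {..<length ss}"
    have "A r \<subseteq> {..<length js}" using * by (auto simp: decompositions_def PiE_def Pi_def)
    then have "finite (A r)" using finite_subset by blast
    moreover have "A r \<noteq> {}" using decompositions_nonempty[of A js ss r] * assms by auto
    ultimately have "1 \<le> card (A r)" by (simp add: Suc_le_eq card_gt_0_iff)
    then show "fact (ss ! r - 1) / (fact (ss ! r + 1 - (card (A r) + ls ! r)) * fact (ls ! r - 1))
        \<le> (4 ^ (ss ! r) * fact (card (A r)) :: real)"
      using * assms by (intro fact_quotient_le) auto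
  qed auto
  also have "\<dots> = 4 ^ sum_list ss * (\<Sum>A\<in>?D. \<Prod>r<length ss. fact (card (A r)))"
    by (simp add: prod.distrib sum_distrib_left power_sum[symmetric] sum_list_sum_nth atLeast0LessThan)
  also have "\<dots> \<le> 4 ^ sum_list ss * (\<Sum>A\<in>decompositions js ss. \<Prod>r<length ss. fact (card (A r)))"
    by (intro mult_left_mono sum_mono2) (auto simp: finite_decompositions intro: prod_nonneg)
  finally show ?thesis .
qed

lemma sum_decompositions_le:
  assumes "finite SS" "\<And>ss. ss \<in> SS \<Longrightarrow> length ss = m \<and> (\<forall>s\<in>set ss. 1 \<le> s)"
  shows "2 ^ m * (\<Sum>ss\<in>SS. \<Sum>A\<in>decompositions js ss. \<Prod>r<length ss. fact (card (A r)) :: real)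
    \<le> fact (length js) * 3 ^ length js"
proof -
  let ?f = "\<lambda>A. \<Prod>r<m. fact (card (A r)) :: real"
  have "(\<Sum>ss\<in>SS. \<Sum>A\<in>decompositions js ss. \<Prod>r<length ss. fact (card (A r)) :: real)
     = (\<Sum>ss\<in>SS. \<Sum>A\<in>decompositions js ss. ?f A)"
    using assms by (intro sum.cong) auto
  also have "\<dots> = (\<Sum>A\<in>(\<Union>ss\<in>SS. decompositions js ss). ?f A)"
  proof (rule sum.UNION_disjoint[symmetric])
    show "\<forall>ss\<in>SS. \<forall>ss'\<in>SS. ss \<noteq> ss' \<longrightarrow> decompositions js ss \<inter> decompositions js ss' = {}"
    proof (intro ballI impI)
      fix ss ss' assume *: "ss \<in> SS" "ss' \<in> SS" "ss \<noteq> ss'"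
      then obtain r where r: "r < m" "ss ! r \<noteq> ss' ! r" using assms(2) nth_equalityI by metis
      then show "decompositions js ss \<inter> decompositions js ss' = {}"
        using assms(2)[OF *(1)] assms(2)[OF *(2)] by (auto simp: decompositions_def)
    qed
  qed (use assms finite_decompositions in auto)
  also have "\<dots> \<le> (\<Sum>A\<in>ordered_partitions {..<length js} m. ?f A)"
  proof (rule sum_mono2)
    show "(\<Union>ss\<in>SS. decompositions js ss) \<subseteq> ordered_partitions {..<length js} m"
    proof
      fix A assume "A \<in> (\<Union>ss\<in>SS. decompositions js ss)"
      then obtain ss where "ss \<in> SS" "A \<in> decompositions js ss" by blast
      then show "A \<in> ordered_partitions {..<length js} m"
        using assms(2)[of ss] decompositions_nonempty[of A js ss]
        by (auto simp: decompositions_def ordered_partitions_def)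
    qed
  qed (auto intro: finite_ordered_partitions prod_nonneg)
  finally have "2 ^ m * (\<Sum>ss\<in>SS. \<Sum>A\<in>decompositions js ss. \<Prod>r<length ss. fact (card (A r)) :: real)
     \<le> 2 ^ m * (\<Sum>A\<in>ordered_partitions {..<length js} m. ?f A)"
    by (intro mult_left_mono) auto
  also have "\<dots> \<le> fact (length js) * 3 ^ length js"
    using sum_ordered_partitions_fact_le[of "{..<length js}" m] by simp
  finally show ?thesis .
qed

section \<open>The coefficients $N^1$\<close>

lemma length_le_sum_list: "\<forall>x\<in>set xs. 1 \<le> x \<Longrightarrow> length xs \<le> sum_list (xs :: nat list)"
  by (induction xs) auto

lemma sum_list_le_length_mult: "\<forall>x\<in>set xs. x \<le> n \<Longrightarrow> sum_list xs \<le> n * length (xs :: nat list)"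
  by (induction xs) auto

lemma sum_list_diff_1: "\<forall>l\<in>set ls. 1 \<le> l \<Longrightarrow> (\<Sum>l\<leftarrow>ls. l - 1) + length ls = sum_list (ls :: nat list)"
  by (induction ls) auto

lemma sum_power_div_fact_le_exp:
  fixes x :: real
  assumes "0 \<le> x" "finite M"
  shows "(\<Sum>m\<in>M. x ^ m / fact m) \<le> exp x"
proof -
  have "(\<lambda>m. x ^ m / fact m) sums exp x"
    using exp_converges[of x] by (simp add: field_simps)
  then show ?thesis
    using assms sum_le_suminf[of "\<lambda>m. x ^ m / fact m" M] by (auto simp: sums_iff)
qed

text \<open>
  The bound for \<open>coef_T2\<close> depends on the tuples only through their length \<open>m\<close>. For fixed \<open>m\<close> there are
  at most \<open>2 ^ (m + k - 2)\<close> tuples \<open>ls\<close>, and for each of them the sum of \<open>coef_S\<close> over all \<open>ss\<close>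
  is a sum over ordered partitions; the powers of \<open>2\<close> that depend on \<open>m\<close> cancel. The remaining
  sum over \<open>m\<close> is part of the series of \<open>exp (n * (k - 1))\<close>.
\<close>

lemma N1_range_sum_le:
  assumes k: "2 \<le> length is" and "is": "\<forall>i\<in>set is. 1 \<le> i \<and> i \<le> n"
  shows "(\<Sum>(ss, ls)\<in>N1_range is. coef_S js ss ls * coef_T2 is ss ls)
    \<le> fact (length is) * fact (length js) * (2 * exp (real n)) ^ length is * 3 ^ length js * 4 ^ sum_list is"
proof -
  define k i where "k = length is" "i = sum_list is"
  define SS where "SS = (\<lambda>m. {ss :: nat list. length ss = m \<and> (\<forall>s\<in>set ss. 1 \<le> s) \<and> sum_list ss = i})"
  define LS where "LS = (\<lambda>m. {ls :: nat list. length ls = m \<and> (\<forall>l\<in>set ls. 1 \<le> l) \<and> sum_list ls = m + k - 2})"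
  define b where "b = (\<lambda>m. real n ^ (m - 1) * fact (k - 2) * real (k - 1) ^ m / fact m)"
  define R where "R = (fact (length js) * 3 ^ length js :: real)"
  have n: "1 \<le> n" using assms by (cases "is") auto
  have b0: "0 \<le> b m" for m by (simp add: b_def)
  have finSS: "finite (SS m)" for m
    by (rule finite_subset[OF _ finite_positive_lists_sum_le[of i]]) (auto simp: SS_def)
  have subLS: "LS m \<subseteq> compositions (m + k - 2)" for m
    by (auto simp: LS_def compositions_def)
  then have finLS: "finite (LS m)" for m using finite_compositions finite_subset by blast
  have cardLS: "real (card (LS m)) \<le> 2 ^ (m + k - 2)" for m
  proof -
    have "card (LS m) \<le> 2 ^ (m + k - 2)"
      using card_mono[OF finite_compositions subLS] card_compositions_le le_trans by blast
    then show ?thesis by (metis of_nat_le_iff of_nat_numeral of_nat_power)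
  qed
  have "(\<Sum>(ss, ls)\<in>N1_range is. coef_S js ss ls * coef_T2 is ss ls)
    \<le> (\<Sum>(ss, ls)\<in>N1_range is. coef_S js ss ls * b (length ss))"
  proof (rule sum_mono, clarify)
    fix ss ls assume *: "(ss, ls) \<in> N1_range is"
    have "(\<Sum>l\<leftarrow>ls. l - 1) = k - 2"
      using * sum_list_diff_1[of ls] k by (auto simp: N1_range_def k_i_def)
    then have "coef_T2 is ss ls \<le> b (length ss)"
      unfolding b_def using * assms by (intro coef_T2_le) (auto simp: N1_range_def k_i_def)
    then show "coef_S js ss ls * coef_T2 is ss ls \<le> coef_S js ss ls * b (length ss)"
      by (intro mult_left_mono coef_S_nonneg)
  qed
  \<comment> \<open>sort the tuples by their length and let \<open>ss\<close> and \<open>ls\<close> vary independently\<close>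
  also have "\<dots> = (\<Sum>m=1..i. \<Sum>(ss, ls)\<in>{x \<in> N1_range is. length (fst x) = m}. coef_S js ss ls * b (length ss))"
  proof (rule sum.group[symmetric])
    show "(\<lambda>x. length (fst x)) ` N1_range is \<subseteq> {1..i}"
      using length_le_sum_list by (force simp: N1_range_def k_i_def)
  qed (auto simp: finite_N1_range)
  also have "\<dots> \<le> (\<Sum>m=1..i. \<Sum>(ss, ls)\<in>SS m \<times> LS m. coef_S js ss ls * b m)"
  proof (rule sum_mono)
    fix m
    have "(\<Sum>(ss, ls)\<in>{x \<in> N1_range is. length (fst x) = m}. coef_S js ss ls * b (length ss))
      = (\<Sum>(ss, ls)\<in>{x \<in> N1_range is. length (fst x) = m}. coef_S js ss ls * b m)"
      by (rule sum.cong) auto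
    also have "\<dots> \<le> (\<Sum>(ss, ls)\<in>SS m \<times> LS m. coef_S js ss ls * b m)"
    proof (rule sum_mono2)
      show "finite (SS m \<times> LS m)" using finSS finLS by simp
    qed (auto simp: coef_S_nonneg b0 N1_range_def SS_def LS_def k_i_def)
    finally show "(\<Sum>(ss, ls)\<in>{x \<in> N1_range is. length (fst x) = m}. coef_S js ss ls * b (length ss))
       \<le> (\<Sum>(ss, ls)\<in>SS m \<times> LS m. coef_S js ss ls * b m)" .
  qed
  also have "\<dots> = (\<Sum>m=1..i. \<Sum>ls\<in>LS m. b m * (\<Sum>ss\<in>SS m. coef_S js ss ls))"
    by (subst sum.cartesian_product[symmetric], subst sum.swap) (simp add: sum_distrib_left mult.commute)
  also have "\<dots> \<le> (\<Sum>m=1..i. \<Sum>ls\<in>LS m. b m * (4 ^ i * (R / 2 ^ m)))"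
  proof (intro sum_mono mult_left_mono b0)
    fix m ls assume ls: "ls \<in> LS m"
    have "(\<Sum>ss\<in>SS m. coef_S js ss ls) \<le> (\<Sum>ss\<in>SS m. 4 ^ i * (\<Sum>A\<in>decompositions js ss. \<Prod>r<length ss. fact (card (A r))))"
    proof (rule sum_mono)
      fix ss assume "ss \<in> SS m"
      then show "coef_S js ss ls \<le> 4 ^ i * (\<Sum>A\<in>decompositions js ss. \<Prod>r<length ss. fact (card (A r)))"
        using coef_S_le[of ls ss js] ls by (simp add: SS_def LS_def)
    qed
    also have "\<dots> = 4 ^ i * (\<Sum>ss\<in>SS m. \<Sum>A\<in>decompositions js ss. \<Prod>r<length ss. fact (card (A r)))"
      by (simp add: sum_distrib_left)
    also have "\<dots> \<le> 4 ^ i * (R / 2 ^ m)"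
    proof (rule mult_left_mono)
      have "2 ^ m * (\<Sum>ss\<in>SS m. \<Sum>A\<in>decompositions js ss. \<Prod>r<length ss. fact (card (A r)) :: real) \<le> R"
        unfolding R_def by (rule sum_decompositions_le[OF finSS]) (auto simp: SS_def)
      then show "(\<Sum>ss\<in>SS m. \<Sum>A\<in>decompositions js ss. \<Prod>r<length ss. fact (card (A r))) \<le> R / 2 ^ m"
        by (subst pos_le_divide_eq) (simp_all only: mult.commute zero_less_power zero_less_numeral)
    qed simp
    finally show "(\<Sum>ss\<in>SS m. coef_S js ss ls) \<le> 4 ^ i * (R / 2 ^ m)" .
  qed
  also have "\<dots> = (\<Sum>m=1..i. real (card (LS m)) * (b m * (4 ^ i * (R / 2 ^ m))))"
    by simp
  also have "\<dots> \<le> (\<Sum>m=1..i. 2 ^ (m + k - 2) * (b m * (4 ^ i * (R / 2 ^ m))))"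
    by (intro sum_mono mult_right_mono cardLS mult_nonneg_nonneg b0) (auto simp: R_def)
  also have "\<dots> = (\<Sum>m=1..i. 2 ^ (k - 2) * 4 ^ i * R * b m)"
  proof (rule sum.cong)
    fix m
    have "m + k - 2 = m + (k - 2)" using k by (simp add: k_i_def)
    then show "2 ^ (m + k - 2) * (b m * (4 ^ i * (R / 2 ^ m))) = 2 ^ (k - 2) * 4 ^ i * R * b m"
      by (simp add: power_add)
  qed simp
  also have "\<dots> \<le> (\<Sum>m=1..i. 2 ^ (k - 2) * 4 ^ i * R * (fact (k - 2) * (real (n * (k - 1)) ^ m / fact m)))"
  proof (intro sum_mono mult_left_mono)
    fix m
    have "real n ^ (m - 1) \<le> real n ^ m" using n by (intro power_increasing) auto
    then have "b m \<le> real n ^ m * fact (k - 2) * real (k - 1) ^ m / fact m"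
      unfolding b_def by (intro divide_right_mono mult_right_mono) auto
    then show "b m \<le> fact (k - 2) * (real (n * (k - 1)) ^ m / fact m)"
      by (simp add: power_mult_distrib mult_ac)
  qed (auto simp: R_def)
  also have "\<dots> = 2 ^ (k - 2) * 4 ^ i * R * (fact (k - 2) * (\<Sum>m=1..i. real (n * (k - 1)) ^ m / fact m))"
    by (simp only: sum_distrib_left)
  also have "\<dots> \<le> 2 ^ k * 4 ^ i * R * (fact k * exp (real n) ^ k)"
  proof (intro mult_mono)
    have "(\<Sum>m=1..i. real (n * (k - 1)) ^ m / fact m) \<le> exp (real (n * (k - 1)))"
      by (rule sum_power_div_fact_le_exp) auto
    also have "\<dots> \<le> exp (real k * real n)"
    proof -
      have "n * (k - 1) \<le> k * n" by simp
      then show ?thesis by (metis exp_le_cancel_iff of_nat_le_iff of_nat_mult)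
    qed
    finally show "(\<Sum>m=1..i. real (n * (k - 1)) ^ m / fact m) \<le> exp (real n) ^ k" by (simp add: exp_of_nat_mult)
    show "fact (k - 2) \<le> (fact k :: real)" by (rule fact_mono) simp
    show "2 ^ (k - 2) \<le> (2 ^ k :: real)" by (rule power_increasing) auto
  qed (auto simp: R_def intro!: sum_nonneg mult_nonneg_nonneg)
  also have "\<dots> = fact k * fact (length js) * (2 * exp (real n)) ^ k * 3 ^ length js * 4 ^ i"
    by (simp add: R_def power_mult_distrib mult_ac)
  finally show ?thesis by (simp add: k_i_def)
qed

lemma fact_quotient_single_le:
  assumes "1 \<le> k" "k \<le> i"
  shows "fact (i - 1) / fact (i + 1 - k) \<le> (fact k * 4 ^ i :: real)"
proof (cases "k = 1")
  case True
  have "fact (i - 1) \<le> (fact i :: real)" by (rule fact_mono) simp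
  then have "fact (i - 1) / fact i \<le> (1 :: real)" by simp
  also have "1 \<le> (4 ^ i :: real)" by simp
  finally show ?thesis using True by simp
next
  case False
  then have "fact (i - 1) / (fact (i + 1 - (k - 1 + 1)) * fact (1 - 1)) \<le> (4 ^ i * fact (k - 1) :: real)"
    using assms by (intro fact_quotient_le) auto
  also have "\<dots> \<le> 4 ^ i * fact k" by (intro mult_left_mono fact_mono) auto
  finally show ?thesis using assms by (simp add: mult.commute)
qed

lemma exp_of_nat_le_power4: "exp (real n) \<le> 4 ^ n"
proof -
  have "exp (real n) = exp 1 ^ n" using exp_of_nat_mult[of n 1] by simp
  also have "\<dots> \<le> 4 ^ n" using exp_le by (intro power_mono) auto
  finally show ?thesis .
qed

text \<open>
  The factor \<open>4 ^ i\<close> of the preceding bound is harmless since \<open>i\<close> is the sum of the entries of \<open>js\<close>,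
  which are at most \<open>n\<close>; so \<open>4 ^ i\<close> costs a factor \<open>4 ^ n\<close> per entry.
\<close>

lemma abs_coef_N1_le:
  assumes "is \<noteq> []" "\<forall>i\<in>set is. 1 \<le> i \<and> i \<le> n"
    and "js \<noteq> []" "\<forall>j\<in>set js. 1 \<le> j \<and> j \<le> n"
  shows "\<bar>coef_N1 i is js\<bar> \<le> fact (length is) * fact (length js) * (4 * 4 ^ n) ^ (length is + length js)"
proof (cases "i = sum_list is \<and> i = sum_list js")
  case False
  then have "coef_N1 i is js = 0" by (auto simp: coef_N1_def)
  then show ?thesis by simp
next
  case True
  let ?k = "length is" and ?l = "length js"
  have k: "1 \<le> ?k" "1 \<le> ?l" "?k \<le> i" "?l \<le> i"
    using assms True length_le_sum_list[of "is"] length_le_sum_list[of js] by (auto simp: Suc_le_eq)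
  have "i \<le> n * ?l" using sum_list_le_length_mult[of js n] assms True by simp
  then have "(4 :: real) ^ i \<le> 4 ^ (n * ?l)" by (intro power_increasing) auto
  then have i4: "(4 :: real) ^ i \<le> (4 ^ n) ^ ?l" by (simp add: power_mult)
  have C: "fact ?k * fact ?l * (2 * exp (real n)) ^ ?k * 3 ^ ?l * 4 ^ i
    \<le> fact ?k * fact ?l * (4 * 4 ^ n) ^ (?k + ?l)"
  proof -
    have "fact ?k * fact ?l * (2 * exp (real n)) ^ ?k * 3 ^ ?l * 4 ^ i
      \<le> fact ?k * fact ?l * (4 * 4 ^ n) ^ ?k * 4 ^ ?l * (4 ^ n) ^ ?l"
      using i4 exp_of_nat_le_power4[of n]
      by (intro mult_mono power_mono) auto
    also have "\<dots> = fact ?k * fact ?l * (4 * 4 ^ n) ^ (?k + ?l)"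
      by (simp only: power_add power_mult_distrib mult_ac)
    finally show ?thesis .
  qed
  have D: "fact ?k * fact ?l * 4 ^ i \<le> fact ?k * fact ?l * (2 * exp (real n)) ^ ?k * 3 ^ ?l * 4 ^ i"
  proof -
    have "1 \<le> 2 * exp (real n)" using one_le_exp_iff[of "real n"] by linarith
    then have "1 \<le> (2 * exp (real n)) ^ ?k" by (rule one_le_power)
    then have "1 * 1 \<le> (2 * exp (real n)) ^ ?k * 3 ^ ?l" by (intro mult_mono) auto
    then have "(fact ?k * fact ?l * 4 ^ i) * 1 \<le> (fact ?k * fact ?l * 4 ^ i) * ((2 * exp (real n)) ^ ?k * 3 ^ ?l)"
      by (intro mult_left_mono) auto
    then show ?thesis by (simp add: mult_ac)
  qed
  consider "?k = 1" | "?k \<noteq> 1" "?l = 1" | "2 \<le> ?k" "?l \<noteq> 1" using k by linarith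
  then show ?thesis
  proof cases
    case 1
    then have "\<bar>coef_N1 i is js\<bar> = fact (i - 1) / fact (i + 1 - ?l)"
      using True by (simp add: coef_N1_def)
    also have "\<dots> \<le> fact ?l * 4 ^ i" using k by (intro fact_quotient_single_le)
    also have "\<dots> = fact ?k * fact ?l * 4 ^ i" using 1 by simp
    also note order_trans[OF D C]
    finally show ?thesis .
  next
    case 2
    then have "\<bar>coef_N1 i is js\<bar> = fact (i - 1) / fact (i + 1 - ?k)"
      using True by (simp add: coef_N1_def)
    also have "\<dots> \<le> fact ?k * 4 ^ i" using k by (intro fact_quotient_single_le)
    also have "\<dots> = fact ?k * fact ?l * 4 ^ i" using 2 by simp
    also note order_trans[OF D C]
    finally show ?thesis .
  next
    case 3
    then have "\<bar>coef_N1 i is js\<bar> = \<bar>\<Sum>(ss, ls)\<in>N1_range is. (-1) ^ (length ss + 1) * coef_S js ss ls * coef_T2 is ss ls\<bar>"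
      using True by (simp add: coef_N1_def)
    also have "\<dots> \<le> (\<Sum>(ss, ls)\<in>N1_range is. coef_S js ss ls * coef_T2 is ss ls)"
      by (rule order_trans[OF sum_abs], rule sum_mono)
         (auto simp: abs_mult coef_S_nonneg coef_T2_nonneg)
    also have "\<dots> \<le> fact ?k * fact ?l * (2 * exp (real n)) ^ ?k * 3 ^ ?l * 4 ^ sum_list is"
      using 3 assms by (intro N1_range_sum_le) auto
    also have "sum_list is = i" using True by simp
    also note C
    finally show ?thesis .
  qed
qed

section \<open>Absolute convergence\<close>

text \<open>
  The multinomial coefficient with lower entries \<open>m\<close> is one term in the expansion of
  \<open>(1 + \<dots> + 1) ^ multiplicity_sum ps\<close> with \<open>length ps\<close> summands.
\<close>

lemma fact_multiplicity_sum_le: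
  "fact (multiplicity_sum ps) \<le> (\<Prod>(j, m)\<leftarrow>ps. fact m) * (real (length ps) ^ multiplicity_sum ps)"
proof (induction ps)
  case Nil
  then show ?case by (simp add: multiplicity_sum_def)
next
  case (Cons x ps)
  obtain j m where x: "x = (j, m)" by force
  define M p where "M = multiplicity_sum ps" "p = length ps"
  have M: "multiplicity_sum (x # ps) = m + M" by (simp add: multiplicity_sum_def M_p_def x)
  have f: "fact (m + M) = real (m + M choose m) * (fact m * fact M)"
    by (simp add: binomial_fact)
  have "real (m + M choose m) * real p ^ M = real (m + M choose m) * 1 ^ m * real p ^ (m + M - m)"
    by simp
  also have "\<dots> \<le> (\<Sum>c\<le>m + M. real (m + M choose c) * 1 ^ c * real p ^ (m + M - c))"
    by (rule member_le_sum) auto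
  also have "\<dots> = (1 + real p) ^ (m + M)" by (simp only: binomial_ring)
  finally have b: "real (m + M choose m) * real p ^ M \<le> (1 + real p) ^ (m + M)" .
  have P0: "0 \<le> (\<Prod>(j, m)\<leftarrow>ps. fact m :: real)" by (rule prod_list_nonneg) auto
  have "fact (m + M) \<le> real (m + M choose m) * (fact m * ((\<Prod>(j, m)\<leftarrow>ps. fact m) * real p ^ M))"
    unfolding f using Cons.IH by (intro mult_left_mono) (auto simp: M_p_def)
  also have "\<dots> = fact m * (\<Prod>(j, m)\<leftarrow>ps. fact m) * (real (m + M choose m) * real p ^ M)"
    by (simp add: mult_ac)
  also have "\<dots> \<le> fact m * (\<Prod>(j, m)\<leftarrow>ps. fact m) * (1 + real p) ^ (m + M)"
    using P0 by (intro mult_left_mono b mult_nonneg_nonneg) auto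
  finally show ?case unfolding M by (simp add: x M_p_def add.commute)
qed

lemma length_multi_index_le:
  assumes "ps \<in> multi_index" "\<forall>(j, m)\<in>set ps. j \<le> n"
  shows "length ps \<le> n"
proof -
  have "length ps = card (fst ` set ps)"
    using assms(1) by (auto simp: multi_index_def strict_sorted_iff distinct_card simp flip: set_map)
  also have "\<dots> \<le> card {1..n}"
    using assms by (intro card_mono) (auto simp: multi_index_def)
  finally show ?thesis by simp
qed

text \<open>
  Half of the term of the series with multi-index \<open>ps\<close>: the factorial and the power of \<open>C\<close> are the
  share of \<open>ps\<close> in the bound for \<open>coef_N2\<close>. As at most \<open>n\<close> different indices occur, the factorial
  cancels against the denominators up to a factor \<open>n\<close> per index.
\<close>

lemma monomial_le_power:
  fixes u :: "nat \<Rightarrow> real"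
  assumes ps: "ps \<in> multi_index" "\<forall>(j, m)\<in>set ps. j \<le> n"
    and u: "\<And>j. 1 \<le> j \<Longrightarrow> j \<le> n \<Longrightarrow> 0 \<le> u j \<and> real j * u j * (real n * C) \<le> r"
    and "0 \<le> C"
  shows "(\<Prod>(j, m)\<leftarrow>ps. real j ^ m / fact m) * (\<Prod>(j, m)\<leftarrow>ps. u j ^ m) *
      (fact (multiplicity_sum ps) * C ^ multiplicity_sum ps) \<le> r ^ multiplicity_sum ps"
proof -
  let ?K = "multiplicity_sum ps"
  have a: "(\<Prod>(j, m)\<leftarrow>ps. real j ^ m / fact m) * (\<Prod>(j, m)\<leftarrow>ps. fact m) = (\<Prod>(j, m)\<leftarrow>ps. real j ^ m)"
    for ps :: "(nat \<times> nat) list"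
  proof (induction ps)
    case (Cons x ps)
    obtain j m where x: "x = (j, m)" by force
    have "(real j ^ m / fact m * a) * (fact m * b) = real j ^ m * (a * b)" for a b :: real by simp
    then show ?case using Cons.IH by (simp only: x list.map prod_list.Cons prod.case)
  qed simp
  have b: "(\<Prod>(j, m)\<leftarrow>ps. real j ^ m) * (\<Prod>(j, m)\<leftarrow>ps. u j ^ m) * D ^ multiplicity_sum ps = (\<Prod>(j, m)\<leftarrow>ps. (real j * u j * D) ^ m)" for D ps
    by (induction ps) (auto simp: multiplicity_sum_def power_mult_distrib power_add)
  have c: "(\<Prod>(j, m)\<leftarrow>ps. (real j * u j * (real n * C)) ^ m) \<le> r ^ multiplicity_sum ps
     \<and> 0 \<le> (\<Prod>(j, m)\<leftarrow>ps. (real j * u j * (real n * C)) ^ m)"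
    if "\<forall>(j, m)\<in>set ps. 1 \<le> j \<and> j \<le> n" for ps
    using that
  proof (induction ps)
    case (Cons x ps)
    obtain j m where x: "x = (j, m)" by force
    have "0 \<le> real j * u j * (real n * C)" "real j * u j * (real n * C) \<le> r"
      using u[of j] Cons.prems x assms(4) by auto
    then have "(real j * u j * (real n * C)) ^ m \<le> r ^ m" "0 \<le> (real j * u j * (real n * C)) ^ m" "0 \<le> r ^ m"
      by (auto intro: power_mono)
    then show ?case using Cons.IH Cons.prems
      by (auto simp: x multiplicity_sum_def power_add intro!: mult_mono)
  qed (simp add: multiplicity_sum_def)
  have pos: "\<forall>(j, m)\<in>set ps. 1 \<le> j \<and> j \<le> n" using ps by (auto simp: multi_index_def)
  have u0: "0 \<le> u j ^ m" if "(j, m) \<in> set ps" for j m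
    using u[of j] pos that by auto
  have nn: "0 \<le> (\<Prod>(j, m)\<leftarrow>ps. real j ^ m / fact m)" "0 \<le> (\<Prod>(j, m)\<leftarrow>ps. u j ^ m)"
      "0 \<le> (\<Prod>(j, m)\<leftarrow>ps. fact m :: real)"
    using u0 by (auto intro!: prod_list_nonneg simp del: zero_le_power_eq)
  have "fact ?K \<le> (\<Prod>(j, m)\<leftarrow>ps. fact m) * real n ^ ?K"
    by (rule order_trans[OF fact_multiplicity_sum_le])
       (use nn length_multi_index_le[OF ps] in \<open>auto intro!: mult_left_mono power_mono\<close>)
  then have "(\<Prod>(j, m)\<leftarrow>ps. real j ^ m / fact m) * (\<Prod>(j, m)\<leftarrow>ps. u j ^ m) * (fact ?K * C ^ ?K)
    \<le> (\<Prod>(j, m)\<leftarrow>ps. real j ^ m / fact m) * (\<Prod>(j, m)\<leftarrow>ps. u j ^ m) * (((\<Prod>(j, m)\<leftarrow>ps. fact m) * real n ^ ?K) * C ^ ?K)"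
    using nn assms(4) by (intro mult_left_mono mult_right_mono mult_nonneg_nonneg) auto
  also have "\<dots> = ((\<Prod>(j, m)\<leftarrow>ps. real j ^ m / fact m) * (\<Prod>(j, m)\<leftarrow>ps. fact m)) * (\<Prod>(j, m)\<leftarrow>ps. u j ^ m) * (real n * C) ^ ?K"
    by (simp add: power_mult_distrib mult_ac)
  also have "\<dots> = (\<Prod>(j, m)\<leftarrow>ps. (real j * u j * (real n * C)) ^ m)"
    by (simp only: a b)
  also have "\<dots> \<le> r ^ ?K" using c[OF pos] by simp
  finally show ?thesis .
qed

lemma sum_lists_prod:
  fixes f :: "'a \<Rightarrow> real"
  assumes "finite A"
  shows "(\<Sum>xs | set xs \<subseteq> A \<and> length xs = p. \<Prod>x\<leftarrow>xs. f x) = (\<Sum>x\<in>A. f x) ^ p"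
proof (induction p)
  case 0
  have "{xs. set xs \<subseteq> A \<and> length xs = 0} = {[]}" by auto
  then show ?case by simp
next
  case (Suc p)
  have "(\<Sum>xs | set xs \<subseteq> A \<and> length xs = Suc p. \<Prod>x\<leftarrow>xs. f x) =
    (\<Sum>(x, xs)\<in>A \<times> {xs. set xs \<subseteq> A \<and> length xs = p}. f x * (\<Prod>x\<leftarrow>xs. f x))"
    by (rule sum.reindex_bij_witness[of _ "\<lambda>(x, xs). x # xs" "\<lambda>xs. (hd xs, tl xs)"])
       (auto simp: length_Suc_conv)
  also have "\<dots> = (\<Sum>x\<in>A. f x) * (\<Sum>xs | set xs \<subseteq> A \<and> length xs = p. \<Prod>x\<leftarrow>xs. f x)"
    by (simp add: sum.cartesian_product[symmetric] sum_product)
  finally show ?case using Suc by simp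
qed

text \<open>
  A multi-index with entries up to \<open>n\<close> is a list of at most \<open>n\<close> pairs \<open>(j, m)\<close>, and the sum over the
  lists of length \<open>p\<close> is the \<open>p\<close>-th power of the sum over the pairs, which is \<open>n\<close> times a part of a
  geometric series.
\<close>

lemma power_multiplicity_sum_summable:
  fixes r :: real
  assumes "0 \<le> r" "r < 1"
  shows "(\<lambda>ps. r ^ multiplicity_sum ps) summable_on {ps \<in> multi_index. \<forall>(j, m)\<in>set ps. j \<le> n}"
    (is "_ summable_on ?I")
proof (rule nonneg_bdd_above_summable_on)
  show "bdd_above (sum (\<lambda>ps. r ^ multiplicity_sum ps) ` {F. F \<subseteq> ?I \<and> finite F})"
  proof (rule bdd_aboveI2)
    fix F assume "F \<in> {F. F \<subseteq> ?I \<and> finite F}"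
    then have F: "F \<subseteq> ?I" "finite F" by auto
    define M where "M = Max (insert 0 (snd ` (\<Union>ps\<in>F. set ps)))"
    have M: "m \<le> M" if "ps \<in> F" "(j, m) \<in> set ps" for ps j m
      unfolding M_def using F that by (intro Max_ge) (auto intro!: rev_image_eqI[of "(j, m)"])
    let ?A = "{1..n} \<times> {..M}"
    let ?f = "\<lambda>ps. r ^ multiplicity_sum ps"
    let ?X = "\<lambda>p. {xs. set xs \<subseteq> ?A \<and> length xs = p}"
    have prod: "?f ps = (\<Prod>x\<leftarrow>ps. r ^ snd x)" for ps
      by (induction ps) (auto simp: multiplicity_sum_def power_add)
    have fin: "finite (?X p)" for p by (rule finite_lists_length_eq) auto
    have "F \<subseteq> (\<Union>p\<le>n. ?X p)"
    proof
      fix ps assume ps: "ps \<in> F"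
      then have "ps \<in> multi_index" "\<forall>(j, m)\<in>set ps. j \<le> n" using F by auto
      moreover from this have "length ps \<le> n" by (rule length_multi_index_le)
      ultimately show "ps \<in> (\<Union>p\<le>n. ?X p)"
        using M[OF ps] by (fastforce simp: multi_index_def)
    qed
    then have "sum ?f F \<le> sum ?f (\<Union>p\<le>n. ?X p)"
      using fin assms by (intro sum_mono2) auto
    also have "\<dots> = (\<Sum>p\<le>n. sum ?f (?X p))"
      using fin by (intro sum.UNION_disjoint) auto
    also have "\<dots> = (\<Sum>p\<le>n. (\<Sum>x\<in>?A. r ^ snd x) ^ p)"
      by (simp only: prod sum_lists_prod[of ?A] finite_cartesian_product finite_atLeastAtMost finite_atMost)
    also have "\<dots> \<le> (\<Sum>p\<le>n. (real n * (1 / (1 - r))) ^ p)"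
    proof (intro sum_mono power_mono)
      have "(\<Sum>m\<le>M. r ^ m) \<le> 1 / (1 - r)"
        using assms sum_le_suminf[of "\<lambda>m. r ^ m" "{..M}"] suminf_geometric[of r] by simp
      moreover have "(\<Sum>x\<in>?A. r ^ snd x) = (\<Sum>j\<in>{1..n}. \<Sum>m\<le>M. r ^ m)"
        by (simp only: sum.cartesian_product case_prod_unfold)
      ultimately show "(\<Sum>x\<in>?A. r ^ snd x) \<le> real n * (1 / (1 - r))"
        by (simp add: mult_left_mono del: times_divide_eq_right)
    qed (use assms in \<open>auto intro: sum_nonneg\<close>)
    finally show "sum ?f F \<le> (\<Sum>p\<le>n. (real n * (1 / (1 - r))) ^ p)" .
  qed
qed (use assms in auto)

lemma length_repeat_entries: "length (repeat_entries ps) = multiplicity_sum ps"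
  by (induction ps) (auto simp: repeat_entries_def multiplicity_sum_def)

lemma set_repeat_entries: "set (repeat_entries ps) \<subseteq> fst ` set ps"
  by (induction ps) (auto simp: repeat_entries_def split: if_splits)

lemma prod_list_norm_power:
  fixes t :: "nat \<Rightarrow> complex"
  shows "norm (\<Prod>(j, m)\<leftarrow>ps. t j ^ m) = (\<Prod>(j, m)\<leftarrow>ps. norm (t j) ^ m)"
  by (induction ps) (auto simp: norm_mult norm_power)

lemma abs_coef_N2_le:
  assumes "ps \<in> multi_index" "\<forall>(j, m)\<in>set ps. j \<le> n" "qs \<in> multi_index" "\<forall>(j, m)\<in>set qs. j \<le> n"
  shows "\<bar>coef_N2 i ps qs\<bar> \<le> fact (multiplicity_sum ps) * fact (multiplicity_sum qs)
    * (4 * 4 ^ n) ^ (multiplicity_sum ps + multiplicity_sum qs)"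
proof -
  have ne: "repeat_entries xs \<noteq> []" if xs: "xs \<in> multi_index" for xs
  proof -
    obtain j m xs' where "xs = (j, m) # xs'" using xs by (cases xs) (auto simp: multi_index_def)
    then show ?thesis using xs by (auto simp: multi_index_def repeat_entries_def)
  qed
  have bd: "\<forall>j\<in>set (repeat_entries xs). 1 \<le> j \<and> j \<le> n"
    if "xs \<in> multi_index" "\<forall>(j, m)\<in>set xs. j \<le> n" for xs
    using that set_repeat_entries[of xs] by (fastforce simp: multi_index_def)
  show ?thesis
    using abs_coef_N1_le[OF ne bd ne bd, OF assms(1) assms(1,2) assms(3) assms(3,4)]
    by (simp add: coef_N2_def length_repeat_entries)
qed

lemma norm_F_term_le:
  assumes ps: "ps \<in> multi_index" "\<forall>(j, m)\<in>set ps. j \<le> n"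
    and qs: "qs \<in> multi_index" "\<forall>(j, m)\<in>set qs. j \<le> n"
    and t: "\<And>j. 1 \<le> j \<Longrightarrow> j \<le> n \<Longrightarrow> real j * norm (t j) * (real n * (4 * 4 ^ n)) \<le> r"
    and t0: "0 \<le> t0" "t0 \<le> 1"
  shows "norm (F_term t0 t (i, ps, qs)) \<le> r ^ multiplicity_sum ps * r ^ multiplicity_sum qs"
proof -
  let ?P = "\<lambda>ps. \<Prod>(j, m)\<leftarrow>ps. real j ^ m / fact m"
  let ?T = "\<lambda>ps. \<Prod>(j, m)\<leftarrow>ps. norm (t j) ^ m"
  let ?K = "multiplicity_sum ps" and ?L = "multiplicity_sum qs"
  let ?C = "4 * 4 ^ n :: real"
  have P0: "0 \<le> ?P xs" "0 \<le> ?T xs" for xs by (auto intro!: prod_list_nonneg)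
  have bound: "?P xs * ?T xs * (fact (multiplicity_sum xs) * ?C ^ multiplicity_sum xs) \<le> r ^ multiplicity_sum xs"
    if "xs \<in> multi_index" "\<forall>(j, m)\<in>set xs. j \<le> n" for xs
    using that t by (intro monomial_le_power[where n = n]) auto
  have c: "norm (\<Prod>(j, m)\<leftarrow>qs. cnj (t j) ^ m) = ?T qs"
    using prod_list_norm_power[of "\<lambda>j. cnj (t j)" qs] by simp
  have "norm (F_term t0 t (i, ps, qs)) = ?P ps * ?P qs * \<bar>coef_N2 i ps qs\<bar> * t0 ^ (i + 2 - (?K + ?L)) * ?T ps * ?T qs"
    using P0 t0 by (simp add: norm_mult prod_list_norm_power c abs_mult del: of_real_mult)
  also have "\<dots> \<le> ?P ps * ?P qs * (fact ?K * fact ?L * ?C ^ (?K + ?L)) * 1 * ?T ps * ?T qs"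
    using P0 t0 abs_coef_N2_le[OF ps qs, of i]
    by (intro mult_mono mult_right_mono mult_left_mono power_le_one) (auto intro!: mult_nonneg_nonneg)
  also have "\<dots> = (?P ps * ?T ps * (fact ?K * ?C ^ ?K)) * (?P qs * ?T qs * (fact ?L * ?C ^ ?L))"
    by (simp only: power_add mult_ac mult_1_right mult_1_left)
  also have "\<dots> \<le> r ^ ?K * r ^ ?L"
    using bound[OF ps] bound[OF qs] P0 by (intro mult_mono) (auto intro!: mult_nonneg_nonneg order_trans[OF _ bound[OF ps]])
  finally show ?thesis .
qed

text \<open>
  The index \<open>i\<close> of a nonzero term is determined by \<open>ps\<close>, so the summation over \<open>i\<close> disappears.
\<close>

lemma F_term_eq_0:
  assumes "\<And>j. j > n \<Longrightarrow> t j = 0" "(i, ps, qs) \<in> F_indices"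
    and "\<not> ((\<forall>(j, m)\<in>set ps. j \<le> n) \<and> (\<forall>(j, m)\<in>set qs. j \<le> n) \<and> i = sum_list (repeat_entries ps))"
  shows "F_term t0 t (i, ps, qs) = 0"
proof -
  have z: "(\<Prod>(j, m)\<leftarrow>xs. t j ^ m) = 0 \<and> (\<Prod>(j, m)\<leftarrow>xs. cnj (t j) ^ m) = 0"
    if "\<not> (\<forall>(j, m)\<in>set xs. j \<le> n)" "xs \<in> multi_index" for xs
  proof -
    obtain j m where jm: "(j, m) \<in> set xs" "n < j"
    proof (rule ccontr)
      assume "\<not> thesis"
      then have "\<not> n < j" if "(j, m) \<in> set xs" for j m using \<open>\<And>j m. (j, m) \<in> set xs \<Longrightarrow> n < j \<Longrightarrow> thesis\<close> that by blast
      then have "\<forall>(j, m)\<in>set xs. j \<le> n" by force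
      with \<open>\<not> (\<forall>(j, m)\<in>set xs. j \<le> n)\<close> show False by contradiction
    qed
    then have "1 \<le> m" using that(2) by (auto simp: multi_index_def)
    with jm have "(j, m) \<in> set xs" "t j ^ m = 0" using assms(1) by auto
    then show ?thesis by (force simp: prod_list_zero_iff image_iff)
  qed
  have "coef_N2 i ps qs = 0" if "i \<noteq> sum_list (repeat_entries ps)"
    using that by (simp add: coef_N2_def coef_N1_def)
  then show ?thesis using assms(2,3) z[of ps] z[of qs] by (auto simp: F_indices_def)
qed

theorem theorem4p2:
  fixes n :: nat and t0 :: real and t :: "nat \<Rightarrow> complex"
  assumes "n \<ge> 1"
    and "\<And>i. i > n \<Longrightarrow> t i = 0"
    and "0 < t0" and "t0 < 1"
    and "\<And>i. 1 \<le> i \<Longrightarrow> i \<le> n \<Longrightarrow> cmod (t i) \<le> 1 / (4 * real n ^ 3 * 2 ^ n * exp (real n))"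
  shows "\<exists>F :: complex.
    (F_term t0 t has_sum (F - of_real (1/2 * t0\<^sup>2 * ln t0 - 3/4 * t0\<^sup>2))) F_indices"
proof -
  \<comment> \<open>\<open>n * n * (4 * 4 ^ n)\<close> times the given bound for \<open>t\<close> is \<open>(1 / n) * (2 / exp 1) ^ n\<close>\<close>
  define r where "r = 2 / exp (1 :: real)"
  have "2 < (\<Sum>m\<in>{0, 1, 2}. 1 ^ m / fact m :: real)" by (simp add: fact_numeral)
  also have "\<dots> \<le> exp 1" by (rule sum_power_div_fact_le_exp) auto
  finally have e: "2 < exp (1 :: real)" .
  have r: "0 \<le> r" "r < 1" using e by (auto simp: r_def)
  define I where "I = {ps \<in> multi_index. \<forall>(j, m)\<in>set ps. j \<le> n}"
  have t: "real j * norm (t j) * (real n * (4 * 4 ^ n)) \<le> r" if j: "1 \<le> j" "j \<le> n" for j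
  proof -
    have "real j * norm (t j) * (real n * (4 * 4 ^ n))
      \<le> real n * (1 / (4 * real n ^ 3 * 2 ^ n * exp (real n))) * (real n * (4 * 4 ^ n))"
      using assms(5)[OF j] j by (intro mult_mono) auto
    also have "\<dots> = (1 / real n) * (2 ^ n / exp (real n))"
    proof -
      have "(4 :: real) ^ n = 2 ^ n * 2 ^ n" by (simp flip: power_mult_distrib)
      then show ?thesis using assms(1) by (simp add: field_simps power3_eq_cube)
    qed
    also have "\<dots> \<le> 1 * (2 ^ n / exp (real n))"
      using assms(1) by (intro mult_right_mono) auto
    also have "\<dots> = r ^ n"
      using exp_of_nat_mult[of n "1 :: real"] by (simp add: r_def power_divide)
    also have "\<dots> \<le> r ^ 1" using r assms(1) by (intro power_decreasing) auto
    finally show ?thesis by simp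
  qed
  have sI: "(\<lambda>ps. r ^ multiplicity_sum ps) summable_on I"
    unfolding I_def by (rule power_multiplicity_sum_summable) fact+
  let ?Z = "{(i, ps, qs). (i, ps, qs) \<in> F_indices \<and> ps \<in> I \<and> qs \<in> I \<and> i = sum_list (repeat_entries ps)}"
  have g: "(\<lambda>(ps, qs). r ^ multiplicity_sum ps * r ^ multiplicity_sum qs) summable_on I \<times> I"
  proof (rule summable_on_SigmaI)
    show "((\<lambda>qs. case (ps, qs) of (ps, qs) \<Rightarrow> r ^ multiplicity_sum ps * r ^ multiplicity_sum qs) has_sum
      r ^ multiplicity_sum ps * (\<Sum>\<^sub>\<infinity>qs\<in>I. r ^ multiplicity_sum qs)) I" for ps
      using has_sum_cmult_right[OF has_sum_infsum[OF sI]] by simp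
    show "(\<lambda>ps. r ^ multiplicity_sum ps * (\<Sum>\<^sub>\<infinity>qs\<in>I. r ^ multiplicity_sum qs)) summable_on I"
      by (rule summable_on_cmult_left[OF sI])
  qed (use r in auto)
  \<comment> \<open>forgetting \<open>i\<close> embeds the support \<open>?Z\<close> of the series into \<open>I \<times> I\<close>\<close>
  have inj: "inj_on snd ?Z" by (auto simp: inj_on_def)
  have "(\<lambda>(ps, qs). r ^ multiplicity_sum ps * r ^ multiplicity_sum qs) summable_on snd ` ?Z"
    by (rule summable_on_subset_banach[OF g]) auto
  then have g': "(\<lambda>x. r ^ multiplicity_sum (fst (snd x)) * r ^ multiplicity_sum (snd (snd x))) summable_on ?Z"
    by (subst (asm) summable_on_reindex[OF inj]) (simp add: o_def case_prod_unfold)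
  have "(\<lambda>x. norm (F_term t0 t x)) summable_on ?Z"
  proof (rule summable_on_comparison_test[OF g'])
    fix x assume "x \<in> ?Z"
    then show "norm (F_term t0 t x) \<le> r ^ multiplicity_sum (fst (snd x)) * r ^ multiplicity_sum (snd (snd x))"
      using t assms(3,4) by (cases x) (auto simp: I_def simp del: F_term.simps intro!: norm_F_term_le[where n = n])
  qed auto
  then have "F_term t0 t summable_on ?Z" by (rule abs_summable_summable)
  also have "?this \<longleftrightarrow> F_term t0 t summable_on F_indices"
  proof (rule summable_on_cong_neutral)
    fix x assume "x \<in> F_indices - ?Z"
    then show "F_term t0 t x = 0"
      using assms(2) by (cases x) (auto simp: I_def F_indices_def simp del: F_term.simps intro!: F_term_eq_0[where n = n])
  qed auto
  finally obtain S where "(F_term t0 t has_sum S) F_indices" by (auto simp: summable_on_def)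
  then show ?thesis
    by (intro exI[of _ "S + of_real (1/2 * t0\<^sup>2 * ln t0 - 3/4 * t0\<^sup>2)"]) simp
qed

end
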